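(* Let $\mathcal{G}$ be a locally compact (not necessarily Hausdorff) étale groupoid, $Y\subset\mathcal{G}^{(0)}$ a subset and $x\in\mathcal{G}^{(0)}\setminus Y$. Assume there is a net $(y_i)_i$ in $Y$ such that $x$ is the only accumulation point of $(y_i)_i$ in $\mathcal{G}^x_x$. Then the representation $\rho_x$ of $C^*_r(\mathcal{G})$ is weakly contained in $\bigoplus_{y\in Y}\rho_y$.
   Context: A locally compact étale groupoid is a groupoid $\mathcal{G}$ with a locally compact, not necessarily Hausdorff, topology such that the groupoid operations are continuous, the unit space $\mathcal{G}^{(0)}$ is locally compact Hausdorff in the relative topology, and the range and source maps $r,s\colon\mathcal{G}\to\mathcal{G}^{(0)}$ are local homeomorphisms. Write $\mathcal{G}_x=s^{-1}(x)$, $\mathcal{G}^x=r^{-1}(x)$, $\mathcal{G}^x_x=\mathcal{G}_x\cap\mathcal{G}^x$ (isotropy group, with unit $x$; accumulation points of a net in $Y\subset\mathcal{G}^{(0)}\subset\mathcal{G}$ are taken with respect to the topology of $\mathcal{G}$). For an open Hausdorff $V\subset\mathcal{G}$, functions in $C_c(V)$ are extended by zero to $\mathcal{G}$; $C_c(\mathcal{G})$ is the linear span, inside all functions on $\mathcal{G}$, of the spaces $C_c(V)$ over all open Hausdorff $V\subset\mathcal{G}$. It is a $*$-algebra with $(f_1*f_2)(g)=\sum_{h\in\mathcal{G}^{r(g)}}f_1(h)f_2(h^{-1}g)$ and $f^*(g)=\overline{f(g^{-1})}$. For $x\in\mathcal{G}^{(0)}$, $\rho_x\colon C_c(\mathcal{G})\to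 B(\ell^2(\mathcal{G}_x))$ is $(\rho_x(f)\xi)(g)=\sum_{h\in\mathcal{G}^{r(g)}}f(h)\xi(h^{-1}g)$. The reduced C$^*$-algebra $C^*_r(\mathcal{G})$ is the completion of $C_c(\mathcal{G})$ in the norm $\|f\|_r=\sup_{x\in\mathcal{G}^{(0)}}\|\rho_x(f)\|$; each $\rho_x$ extends to $C^*_r(\mathcal{G})$. A representation $\pi$ is weakly contained in a representation $\sigma$ if $\ker\sigma\subset\ker\pi$. *)

theory Defs
  imports "HOL-Analysis.Analysis" "HOL-Library.Function_Algebras"
begin

text \<open>
  Addition, subtraction and zero of functions are pointwise (Function_Algebras).
  A groupoid is given by its space of arrows, the topspace of \<open>gtop\<close>; units are
  arrows, and \<open>gmult g h\<close> is only meaningful if \<open>gsrc g = grng h\<close>.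
\<close>

section \<open>Etale groupoids\<close>

record 'g top_groupoid =
  gtop :: "'g topology"
  grng :: "'g \<Rightarrow> 'g"
  gsrc :: "'g \<Rightarrow> 'g"
  gmult :: "'g \<Rightarrow> 'g \<Rightarrow> 'g"
  ginv :: "'g \<Rightarrow> 'g"

definition arrows :: "'g top_groupoid \<Rightarrow> 'g set" where
  "arrows G = topspace (gtop G)"

definition unit_space :: "'g top_groupoid \<Rightarrow> 'g set" where
  "unit_space G = {u \<in> arrows G. gsrc G u = u \<and> grng G u = u}"

definition composable :: "'g top_groupoid \<Rightarrow> ('g \<times> 'g) set" where
  "composable G = {(g, h). g \<in> arrows G \<and> h \<in> arrows G \<and> gsrc G g = grng G h}"

definition src_fibre :: "'g top_groupoid \<Rightarrow> 'g \<Rightarrow> 'g set" where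
  "src_fibre G x = {g \<in> arrows G. gsrc G g = x}"

definition rng_fibre :: "'g top_groupoid \<Rightarrow> 'g \<Rightarrow> 'g set" where
  "rng_fibre G x = {g \<in> arrows G. grng G g = x}"

definition isotropy :: "'g top_groupoid \<Rightarrow> 'g \<Rightarrow> 'g set" where
  "isotropy G x = src_fibre G x \<inter> rng_fibre G x"

definition local_homeomorphism :: "'a topology \<Rightarrow> 'b topology \<Rightarrow> ('a \<Rightarrow> 'b) \<Rightarrow> bool" where
  "local_homeomorphism X Y f \<longleftrightarrow>
     (\<forall>a \<in> topspace X. \<exists>U. openin X U \<and> a \<in> U \<and> openin Y (f ` U) \<and>
        homeomorphic_map (subtopology X U) (subtopology Y (f ` U)) f)"

locale groupoid =
  fixes G :: "'g top_groupoid"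
  assumes src_unit: "g \<in> arrows G \<Longrightarrow> gsrc G g \<in> unit_space G"
    and rng_unit: "g \<in> arrows G \<Longrightarrow> grng G g \<in> unit_space G"
    and mult_closed: "(g, h) \<in> composable G \<Longrightarrow> gmult G g h \<in> arrows G"
    and src_mult: "(g, h) \<in> composable G \<Longrightarrow> gsrc G (gmult G g h) = gsrc G h"
    and rng_mult: "(g, h) \<in> composable G \<Longrightarrow> grng G (gmult G g h) = grng G g"
    and mult_assoc: "(g, h) \<in> composable G \<Longrightarrow> (h, k) \<in> composable G \<Longrightarrow>
           gmult G (gmult G g h) k = gmult G g (gmult G h k)"
    and mult_src: "g \<in> arrows G \<Longrightarrow> gmult G g (gsrc G g) = g"
    and rng_mult_self: "g \<in> arrows G \<Longrightarrow> gmult G (grng G g) g = g"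
    and inv_closed: "g \<in> arrows G \<Longrightarrow> ginv G g \<in> arrows G"
    and src_inv: "g \<in> arrows G \<Longrightarrow> gsrc G (ginv G g) = grng G g"
    and rng_inv: "g \<in> arrows G \<Longrightarrow> grng G (ginv G g) = gsrc G g"
    and mult_inv: "g \<in> arrows G \<Longrightarrow> gmult G g (ginv G g) = grng G g"
    and inv_mult: "g \<in> arrows G \<Longrightarrow> gmult G (ginv G g) g = gsrc G g"

locale etale_groupoid = groupoid +
  assumes continuous_mult:
      "continuous_map (subtopology (prod_topology (gtop G) (gtop G)) (composable G)) (gtop G)
         (\<lambda>(g, h). gmult G g h)"
    and continuous_inv: "continuous_map (gtop G) (gtop G) (ginv G)"
    and locally_compact: "locally_compact_space (gtop G)"
    and locally_compact_units: "locally_compact_space (subtopology (gtop G) (unit_space G))"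
    and Hausdorff_units: "Hausdorff_space (subtopology (gtop G) (unit_space G))"
    and local_homeomorphism_src:
      "local_homeomorphism (gtop G) (subtopology (gtop G) (unit_space G)) (gsrc G)"
    and local_homeomorphism_rng:
      "local_homeomorphism (gtop G) (subtopology (gtop G) (unit_space G)) (grng G)"


section \<open>Nets\<close>

definition directed_set :: "'i set \<Rightarrow> ('i \<Rightarrow> 'i \<Rightarrow> bool) \<Rightarrow> bool" where
  "directed_set I le \<longleftrightarrow> I \<noteq> {} \<and> (\<forall>i\<in>I. le i i) \<and>
     (\<forall>i\<in>I. \<forall>j\<in>I. \<forall>k\<in>I. le i j \<longrightarrow> le j k \<longrightarrow> le i k) \<and>
     (\<forall>i\<in>I. \<forall>j\<in>I. \<exists>k\<in>I. le i k \<and> le j k)"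

definition accumulation_point ::
    "'a topology \<Rightarrow> 'i set \<Rightarrow> ('i \<Rightarrow> 'i \<Rightarrow> bool) \<Rightarrow> ('i \<Rightarrow> 'a) \<Rightarrow> 'a \<Rightarrow> bool" where
  "accumulation_point X I le y a \<longleftrightarrow> a \<in> topspace X \<and>
     (\<forall>U. openin X U \<and> a \<in> U \<longrightarrow> (\<forall>i\<in>I. \<exists>j\<in>I. le i j \<and> y j \<in> U))"


section \<open>The convolution algebra\<close>

definition Cc_on :: "'g topology \<Rightarrow> 'g set \<Rightarrow> ('g \<Rightarrow> complex) set" where
  "Cc_on X V = {f. continuous_map (subtopology X V) euclidean f \<and>
     compactin (subtopology X V) (subtopology X V closure_of {g \<in> V. f g \<noteq> 0}) \<and>
     (\<forall>g. g \<notin> V \<longrightarrow> f g = 0)}"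

definition Cc :: "'g top_groupoid \<Rightarrow> ('g \<Rightarrow> complex) set" where
  "Cc G = {f. \<exists>(n::nat) c u.
     (\<forall>k<n. \<exists>V. openin (gtop G) V \<and> Hausdorff_space (subtopology (gtop G) V) \<and>
        u k \<in> Cc_on (gtop G) V) \<and>
     f = (\<lambda>g. \<Sum>k<n. c k * u k g)}"

text \<open>
  Functions on the groupoid are extended by zero outside \<open>arrows G\<close>.
  The sum in \<open>conv\<close> and \<open>rho\<close> has finitely many nonzero terms if \<open>f1\<close>, \<open>f\<close> are in \<open>Cc G\<close>.
\<close>

definition conv :: "'g top_groupoid \<Rightarrow> ('g \<Rightarrow> complex) \<Rightarrow> ('g \<Rightarrow> complex) \<Rightarrow> 'g \<Rightarrow> complex" where
  "conv G f1 f2 = (\<lambda>g. if g \<in> arrows G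
     then \<Sum>\<^sub>\<infinity>h\<in>rng_fibre G (grng G g). f1 h * f2 (gmult G (ginv G h) g) else 0)"

definition adj :: "'g top_groupoid \<Rightarrow> ('g \<Rightarrow> complex) \<Rightarrow> 'g \<Rightarrow> complex" where
  "adj G f = (\<lambda>g. if g \<in> arrows G then cnj (f (ginv G g)) else 0)"


section \<open>Bounded operators on l2 spaces\<close>

definition ell2 :: "'a set \<Rightarrow> ('a \<Rightarrow> complex) set" where
  "ell2 S = {\<xi>. (\<lambda>s. (cmod (\<xi> s))\<^sup>2) summable_on S \<and> (\<forall>s. s \<notin> S \<longrightarrow> \<xi> s = 0)}"

definition ell2_norm :: "'a set \<Rightarrow> ('a \<Rightarrow> complex) \<Rightarrow> real" where
  "ell2_norm S \<xi> = sqrt (\<Sum>\<^sub>\<infinity>s\<in>S. (cmod (\<xi> s))\<^sup>2)"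

text \<open>Operators are normalised to vanish off \<open>ell2 S\<close>, so that they form a set of functions.\<close>

definition bounded_ops :: "'a set \<Rightarrow> (('a \<Rightarrow> complex) \<Rightarrow> 'a \<Rightarrow> complex) set" where
  "bounded_ops S = {T.
     (\<forall>\<xi>\<in>ell2 S. T \<xi> \<in> ell2 S) \<and> (\<forall>\<xi>. \<xi> \<notin> ell2 S \<longrightarrow> T \<xi> = 0) \<and>
     (\<forall>\<xi>\<in>ell2 S. \<forall>\<eta>\<in>ell2 S. T (\<xi> + \<eta>) = T \<xi> + T \<eta>) \<and>
     (\<forall>c. \<forall>\<xi>\<in>ell2 S. T (\<lambda>s. c * \<xi> s) = (\<lambda>s. c * T \<xi> s)) \<and>
     (\<exists>C. \<forall>\<xi>\<in>ell2 S. ell2_norm S (T \<xi>) \<le> C * ell2_norm S \<xi>)}"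

definition op_norm :: "'a set \<Rightarrow> (('a \<Rightarrow> complex) \<Rightarrow> 'a \<Rightarrow> complex) \<Rightarrow> real" where
  "op_norm S T = (SUP \<xi>\<in>{\<xi> \<in> ell2 S. ell2_norm S \<xi> \<le> 1}. ell2_norm S (T \<xi>))"

definition rho :: "'g top_groupoid \<Rightarrow> 'g \<Rightarrow> ('g \<Rightarrow> complex) \<Rightarrow> ('g \<Rightarrow> complex) \<Rightarrow> 'g \<Rightarrow> complex" where
  "rho G x f \<xi> = (\<lambda>g. if \<xi> \<in> ell2 (src_fibre G x) \<and> g \<in> src_fibre G x
     then \<Sum>\<^sub>\<infinity>h\<in>rng_fibre G (grng G g). f h * \<xi> (gmult G (ginv G h) g) else 0)"


section \<open>The reduced C*-algebra\<close>

text \<open>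
  The real supremum in \<open>red_norm\<close> is only used for \<open>f\<close> in \<open>Cc G\<close> over an etale groupoid.
  There it is finite: \<open>f\<close> is a linear combination of functions supported in compact sets, and
  such a set is covered by finitely many open sets on which source and range are injective.
\<close>

definition red_norm :: "'g top_groupoid \<Rightarrow> ('g \<Rightarrow> complex) \<Rightarrow> real" where
  "red_norm G f = (SUP x\<in>unit_space G. op_norm (src_fibre G x) (rho G x f))"

text \<open>
  The completion of \<open>Cc G\<close> consists of the classes of Cauchy sequences modulo null sequences,
  with the operations induced from \<open>Cc G\<close> by acting termwise on representatives.
\<close>

definition cauchy_seqs :: "'g top_groupoid \<Rightarrow> (nat \<Rightarrow> 'g \<Rightarrow> complex) set" where
  "cauchy_seqs G = {\<sigma>. range \<sigma> \<subseteq> Cc G \<and>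
     (\<forall>\<epsilon>>0. \<exists>N. \<forall>m\<ge>N. \<forall>n\<ge>N. red_norm G (\<sigma> m - \<sigma> n) < \<epsilon>)}"

definition null_equiv ::
    "'g top_groupoid \<Rightarrow> ((nat \<Rightarrow> 'g \<Rightarrow> complex) \<times> (nat \<Rightarrow> 'g \<Rightarrow> complex)) set" where
  "null_equiv G = {(\<sigma>, \<tau>). \<sigma> \<in> cauchy_seqs G \<and> \<tau> \<in> cauchy_seqs G \<and>
     (\<lambda>n. red_norm G (\<sigma> n - \<tau> n)) \<longlonglongrightarrow> 0}"

record 'a normed_star_algebra =
  elems :: "'a set"
  alg_add :: "'a \<Rightarrow> 'a \<Rightarrow> 'a"
  alg_scale :: "complex \<Rightarrow> 'a \<Rightarrow> 'a"
  alg_mult :: "'a \<Rightarrow> 'a \<Rightarrow> 'a"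
  alg_star :: "'a \<Rightarrow> 'a"
  alg_norm :: "'a \<Rightarrow> real"

definition reduced_algebra ::
    "'g top_groupoid \<Rightarrow> (nat \<Rightarrow> 'g \<Rightarrow> complex) set normed_star_algebra" where
  "reduced_algebra G = \<lparr>
     elems = cauchy_seqs G // null_equiv G,
     alg_add = (\<lambda>a b. \<Union>\<sigma>\<in>a. \<Union>\<tau>\<in>b. null_equiv G `` {\<lambda>n. \<sigma> n + \<tau> n}),
     alg_scale = (\<lambda>c a. \<Union>\<sigma>\<in>a. null_equiv G `` {\<lambda>n g. c * \<sigma> n g}),
     alg_mult = (\<lambda>a b. \<Union>\<sigma>\<in>a. \<Union>\<tau>\<in>b. null_equiv G `` {\<lambda>n. conv G (\<sigma> n) (\<tau> n)}),
     alg_star = (\<lambda>a. \<Union>\<sigma>\<in>a. null_equiv G `` {\<lambda>n. adj G (\<sigma> n)}),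
     alg_norm = (\<lambda>a. THE r. \<forall>\<sigma>\<in>a. (\<lambda>n. red_norm G (\<sigma> n)) \<longlonglongrightarrow> r) \<rparr>"

text \<open>The extension by continuity of \<open>rho G x\<close> to the completion.\<close>

definition rho_ext ::
    "'g top_groupoid \<Rightarrow> 'g \<Rightarrow> (nat \<Rightarrow> 'g \<Rightarrow> complex) set \<Rightarrow> ('g \<Rightarrow> complex) \<Rightarrow> 'g \<Rightarrow> complex" where
  "rho_ext G x a = (THE T. T \<in> bounded_ops (src_fibre G x) \<and>
     (\<forall>\<sigma>\<in>a. (\<lambda>n. op_norm (src_fibre G x) (rho G x (\<sigma> n) - T)) \<longlonglongrightarrow> 0))"


section \<open>Direct sums and weak containment\<close>

definition ell2_sum :: "'i set \<Rightarrow> ('i \<Rightarrow> 'a set) \<Rightarrow> ('i \<Rightarrow> 'a \<Rightarrow> complex) set" where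
  "ell2_sum Y S = {\<eta>. (\<forall>y\<in>Y. \<eta> y \<in> ell2 (S y)) \<and> (\<forall>y. y \<notin> Y \<longrightarrow> \<eta> y = 0) \<and>
     (\<lambda>y. (ell2_norm (S y) (\<eta> y))\<^sup>2) summable_on Y}"

definition rep_sum ::
    "'i set \<Rightarrow> ('i \<Rightarrow> 'b \<Rightarrow> ('a \<Rightarrow> complex) \<Rightarrow> 'a \<Rightarrow> complex) \<Rightarrow>
     'b \<Rightarrow> ('i \<Rightarrow> 'a \<Rightarrow> complex) \<Rightarrow> 'i \<Rightarrow> 'a \<Rightarrow> complex" where
  "rep_sum Y \<pi> b \<eta> = (\<lambda>y. if y \<in> Y then \<pi> y b (\<eta> y) else 0)"

text \<open>A representation of \<open>A\<close> is passed as its Hilbert space \<open>H\<close> together with the action \<open>\<pi>\<close>.\<close>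

definition rep_kernel :: "'b normed_star_algebra \<Rightarrow> 'h set \<Rightarrow> ('b \<Rightarrow> 'h \<Rightarrow> 'h::zero) \<Rightarrow> 'b set" where
  "rep_kernel A H \<pi> = {b \<in> elems A. \<forall>\<xi>\<in>H. \<pi> b \<xi> = 0}"

definition weakly_contained ::
    "'b normed_star_algebra \<Rightarrow> 'h set \<Rightarrow> ('b \<Rightarrow> 'h \<Rightarrow> 'h::zero) \<Rightarrow>
     'k set \<Rightarrow> ('b \<Rightarrow> 'k \<Rightarrow> 'k::zero) \<Rightarrow> bool" where
  "weakly_contained A H \<pi> K \<sigma> \<longleftrightarrow> rep_kernel A K \<sigma> \<subseteq> rep_kernel A H \<pi>"

end

theory Submission
  imports Defs
begin

text \<open>
  The point is that \<open>\<parallel>\<rho>\<^sub>x(f)\<parallel> \<le> C\<close> for \<open>f \<in> C\<^sub>c(G)\<close> as soon as \<open>\<parallel>\<rho>\<^sub>y(f)\<parallel> \<le> C\<close> for all \<open>y \<in> Y\<close>.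
  The operator \<open>\<rho>\<^sub>x(f)\<close> has the matrix \<open>f(a b\<inverse>)\<close>, \<open>a, b \<in> G\<^sub>x\<close>. Finitely many arrows \<open>a \<in> G\<^sub>x\<close> extend to
  local sections \<open>\<alpha>\<^sub>a\<close> of the source map, and along a subnet of \<open>(y\<^sub>i)\<close> converging to \<open>x\<close> one has
  \<open>f(\<alpha>\<^sub>a(y) \<alpha>\<^sub>b(y)\<inverse>) \<rightarrow> f(a b\<inverse>)\<close>: if \<open>f \<in> C\<^sub>c(V)\<close> and \<open>a b\<inverse> \<notin> V\<close> but the left side stays nonzero, then
  \<open>\<alpha>\<^sub>a(y) \<alpha>\<^sub>b(y)\<inverse>\<close> accumulates at some \<open>h\<close> in the compact support of \<open>f\<close>, and \<open>y\<close> accumulates at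
  \<open>a\<inverse> h b \<in> G\<^sup>x\<^sub>x\<close>, which forces \<open>h = a b\<inverse>\<close>. Thus finite corners of \<open>\<rho>\<^sub>x(f)\<close> are limits of
  corners of \<open>\<rho>\<^sub>y(f)\<close>.
\<close>

section \<open>Square summable functions\<close>

lemma L2_set_le_ell2_norm:
  assumes "\<xi> \<in> ell2 S" "finite F" "F \<subseteq> S"
  shows "L2_set (\<lambda>s. cmod (\<xi> s)) F \<le> ell2_norm S \<xi>"
  unfolding L2_set_def ell2_norm_def
  using assms by (intro real_sqrt_le_mono finite_sum_le_infsum) (auto simp: ell2_def)

text \<open>Membership and norm in l2 are tested on finite subsets, so every later estimate reduces
  to a finite \<open>L2_set\<close> inequality. The empty subset already gives
  \<open>0 \<le> C\<close>.\<close>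

lemma ell2_bounded:
  assumes "\<And>s. s \<notin> S \<Longrightarrow> \<xi> s = 0"
    and bd: "\<And>F. finite F \<Longrightarrow> F \<subseteq> S \<Longrightarrow> L2_set (\<lambda>s. cmod (\<xi> s)) F \<le> C"
  shows "\<xi> \<in> ell2 S" "ell2_norm S \<xi> \<le> C"
proof -
  have C: "0 \<le> C"
    using bd[of "{}"] by simp
  have le: "(\<Sum>s\<in>F. (cmod (\<xi> s))\<^sup>2) \<le> C\<^sup>2" if "finite F" "F \<subseteq> S" for F
    using bd[OF that] C by (simp add: L2_set_def real_sqrt_le_iff' sum_nonneg)
  have sm: "(\<lambda>s. (cmod (\<xi> s))\<^sup>2) summable_on S"
    by (rule nonneg_bdd_above_summable_on) (auto intro!: bdd_aboveI2[where M="C\<^sup>2"] le)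
  then show "\<xi> \<in> ell2 S"
    using assms(1) by (simp add: ell2_def)
  have "(\<Sum>\<^sub>\<infinity>s\<in>S. (cmod (\<xi> s))\<^sup>2) \<le> C\<^sup>2"
    by (rule infsum_le_finite_sums[OF sm]) (rule le)
  then show "ell2_norm S \<xi> \<le> C"
    using C by (simp add: ell2_norm_def real_le_lsqrt infsum_nonneg)
qed

lemma ell2_norm_nonneg [simp]: "0 \<le> ell2_norm S \<xi>"
  by (simp add: ell2_norm_def infsum_nonneg)

lemma ell2_zero [simp]: "0 \<in> ell2 S"
  by (simp add: ell2_def)

lemma ell2_norm_zero [simp]: "ell2_norm S 0 = 0"
  by (simp add: ell2_norm_def)

lemma ell2_outside: "\<xi> \<in> ell2 S \<Longrightarrow> s \<notin> S \<Longrightarrow> \<xi> s = 0"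
  by (simp add: ell2_def)

lemma cmod_le_ell2_norm:
  assumes "\<xi> \<in> ell2 S"
  shows "cmod (\<xi> s) \<le> ell2_norm S \<xi>"
  using L2_set_le_ell2_norm[OF assms, of "{s}"] ell2_outside[OF assms, of s]
  by (cases "s \<in> S") auto

lemma ell2_norm_eq_0D:
  assumes "\<xi> \<in> ell2 S" "ell2_norm S \<xi> \<le> 0"
  shows "\<xi> = 0"
proof
  fix s show "\<xi> s = 0 s"
    using order_trans[OF cmod_le_ell2_norm[OF assms(1), of s] assms(2)] by simp
qed

lemma
  assumes "\<xi> \<in> ell2 S" "\<eta> \<in> ell2 S"
  shows ell2_add: "\<xi> + \<eta> \<in> ell2 S"
    and ell2_norm_triangle: "ell2_norm S (\<xi> + \<eta>) \<le> ell2_norm S \<xi> + ell2_norm S \<eta>"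
proof -
  have *: "L2_set (\<lambda>s. cmod ((\<xi> + \<eta>) s)) F \<le> ell2_norm S \<xi> + ell2_norm S \<eta>"
    if "finite F" "F \<subseteq> S" for F
  proof -
    have "L2_set (\<lambda>s. cmod ((\<xi> + \<eta>) s)) F \<le> L2_set (\<lambda>s. cmod (\<xi> s) + cmod (\<eta> s)) F"
      by (rule L2_set_mono) (auto simp: norm_triangle_ineq)
    also have "\<dots> \<le> L2_set (\<lambda>s. cmod (\<xi> s)) F + L2_set (\<lambda>s. cmod (\<eta> s)) F"
      by (rule L2_set_triangle_ineq)
    finally show ?thesis
      using L2_set_le_ell2_norm[OF assms(1) that] L2_set_le_ell2_norm[OF assms(2) that] by simp
  qed
  have 0: "(\<xi> + \<eta>) s = 0" if "s \<notin> S" for s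
    using that assms by (simp add: ell2_def)
  show "\<xi> + \<eta> \<in> ell2 S"
    by (rule ell2_bounded(1)) (fact 0, fact *)
  show "ell2_norm S (\<xi> + \<eta>) \<le> ell2_norm S \<xi> + ell2_norm S \<eta>"
    by (rule ell2_bounded(2)) (fact 0, fact *)
qed

lemma
  assumes "\<xi> \<in> ell2 S"
  shows ell2_scale: "(\<lambda>s. c * \<xi> s) \<in> ell2 S"
    and ell2_norm_scale: "ell2_norm S (\<lambda>s. c * \<xi> s) = cmod c * ell2_norm S \<xi>"
proof -
  have sm: "(\<lambda>s. (cmod c)\<^sup>2 * (cmod (\<xi> s))\<^sup>2) summable_on S"
    using assms by (intro summable_on_cmult_right) (simp add: ell2_def)
  then show "(\<lambda>s. c * \<xi> s) \<in> ell2 S"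
    using assms by (simp add: ell2_def norm_mult power_mult_distrib)
  show "ell2_norm S (\<lambda>s. c * \<xi> s) = cmod c * ell2_norm S \<xi>"
    by (simp add: ell2_norm_def norm_mult power_mult_distrib infsum_cmult_right' real_sqrt_mult)
qed

lemma
  assumes "\<xi> \<in> ell2 S" "\<eta> \<in> ell2 S"
  shows ell2_diff: "\<xi> - \<eta> \<in> ell2 S"
    and ell2_norm_triangle_diff: "ell2_norm S (\<xi> - \<eta>) \<le> ell2_norm S \<xi> + ell2_norm S \<eta>"
proof -
  have eq: "\<xi> - \<eta> = \<xi> + (\<lambda>s. (-1) * \<eta> s)"
    by (simp add: fun_eq_iff)
  show "\<xi> - \<eta> \<in> ell2 S"
    unfolding eq by (intro ell2_add ell2_scale assms)
  show "ell2_norm S (\<xi> - \<eta>) \<le> ell2_norm S \<xi> + ell2_norm S \<eta>"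
    unfolding eq using ell2_norm_triangle[OF assms(1) ell2_scale[OF assms(2), of "-1"]]
      ell2_norm_scale[OF assms(2), of "-1"] by simp
qed


section \<open>Bounded operators\<close>

lemma bounded_ops_ell2: "T \<in> bounded_ops S \<Longrightarrow> \<xi> \<in> ell2 S \<Longrightarrow> T \<xi> \<in> ell2 S"
  by (simp add: bounded_ops_def)

lemma zero_bounded_ops: "0 \<in> bounded_ops S"
  by (auto simp: bounded_ops_def intro!: exI[of _ 0])

lemma bounded_ops_diff:
  assumes "T \<in> bounded_ops S" "U \<in> bounded_ops S"
  shows "T - U \<in> bounded_ops S"
proof -
  obtain C where C: "\<forall>\<xi>\<in>ell2 S. ell2_norm S (T \<xi>) \<le> C * ell2_norm S \<xi>"
    using assms(1) by (auto simp: bounded_ops_def)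
  obtain D where D: "\<forall>\<xi>\<in>ell2 S. ell2_norm S (U \<xi>) \<le> D * ell2_norm S \<xi>"
    using assms(2) by (auto simp: bounded_ops_def)
  have "ell2_norm S ((T - U) \<xi>) \<le> (C + D) * ell2_norm S \<xi>" if "\<xi> \<in> ell2 S" for \<xi>
    using ell2_norm_triangle_diff[OF bounded_ops_ell2[OF assms(1) that] bounded_ops_ell2[OF assms(2) that]]
      bspec[OF C that] bspec[OF D that]
    by (simp add: algebra_simps)
  then have "\<exists>C. \<forall>\<xi>\<in>ell2 S. ell2_norm S ((T - U) \<xi>) \<le> C * ell2_norm S \<xi>"
    by blast
  moreover have "(T - U) \<xi> \<in> ell2 S" if "\<xi> \<in> ell2 S" for \<xi>
    using bounded_ops_ell2[OF assms(1) that] bounded_ops_ell2[OF assms(2) that]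
    by (simp add: ell2_diff)
  ultimately show ?thesis
    using assms by (simp add: bounded_ops_def fun_eq_iff algebra_simps)
qed

lemma op_norm_le:
  assumes "\<And>\<xi>. \<xi> \<in> ell2 S \<Longrightarrow> ell2_norm S (T \<xi>) \<le> C * ell2_norm S \<xi>" "0 \<le> C"
  shows "op_norm S T \<le> C"
  unfolding op_norm_def
proof (rule cSUP_least)
  show "{\<xi> \<in> ell2 S. ell2_norm S \<xi> \<le> 1} \<noteq> {}"
    by (auto intro!: exI[of _ 0])
  fix \<xi> assume "\<xi> \<in> {\<xi> \<in> ell2 S. ell2_norm S \<xi> \<le> 1}"
  then show "ell2_norm S (T \<xi>) \<le> C"
    using assms(1)[of \<xi>] mult_left_mono[OF _ assms(2), of "ell2_norm S \<xi>" 1] by simp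
qed

lemma bdd_above_op_norm:
  assumes "T \<in> bounded_ops S"
  shows "bdd_above ((\<lambda>\<xi>. ell2_norm S (T \<xi>)) ` {\<xi> \<in> ell2 S. ell2_norm S \<xi> \<le> 1})"
proof -
  obtain C where C: "\<forall>\<xi>\<in>ell2 S. ell2_norm S (T \<xi>) \<le> C * ell2_norm S \<xi>"
    using assms by (auto simp: bounded_ops_def)
  show ?thesis
  proof (rule bdd_aboveI2)
    fix \<xi> assume \<xi>: "\<xi> \<in> {\<xi> \<in> ell2 S. ell2_norm S \<xi> \<le> 1}"
    then have "ell2_norm S (T \<xi>) \<le> C * ell2_norm S \<xi>"
      using C by simp
    also have "\<dots> \<le> \<bar>C\<bar> * 1"
      using \<xi> by (intro mult_mono) auto
    finally show "ell2_norm S (T \<xi>) \<le> \<bar>C\<bar>" by simp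
  qed
qed

lemma ell2_norm_le_op_norm:
  assumes T: "T \<in> bounded_ops S" and \<xi>: "\<xi> \<in> ell2 S"
  shows "ell2_norm S (T \<xi>) \<le> op_norm S T * ell2_norm S \<xi>"
proof -
  obtain C where C: "\<forall>\<xi>\<in>ell2 S. ell2_norm S (T \<xi>) \<le> C * ell2_norm S \<xi>"
    using T by (auto simp: bounded_ops_def)
  define r where "r = ell2_norm S \<xi>"
  show ?thesis
  proof (cases "r = 0")
    case True
    \<comment> \<open>A vector of norm 0 cannot be normalised; here the boundedness constant forces
      its image to have norm 0 as well.\<close>
    then show ?thesis using C \<xi> by (auto simp: r_def)
  next
    case False
    then have r: "r > 0" by (simp add: r_def less_le)
    let ?\<zeta> = "\<lambda>s. of_real (1 / r) * \<xi> s"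
    have nz: "ell2_norm S ?\<zeta> = 1"
      unfolding ell2_norm_scale[OF \<xi>] r_def[symmetric] norm_of_real using r by simp
    have "ell2_norm S (T ?\<zeta>) \<le> op_norm S T"
      unfolding op_norm_def by (rule cSUP_upper[OF _ bdd_above_op_norm[OF T]])
        (intro CollectI conjI ell2_scale \<xi> eq_refl nz)
    moreover have "T ?\<zeta> = (\<lambda>s. of_real (1 / r) * T \<xi> s)"
      using T \<xi> unfolding bounded_ops_def by blast
    then have "ell2_norm S (T ?\<zeta>) = 1 / r * ell2_norm S (T \<xi>)"
      using r by (simp only: ell2_norm_scale[OF bounded_ops_ell2[OF T \<xi>]] norm_of_real) simp
    ultimately have "1 / r * ell2_norm S (T \<xi>) \<le> op_norm S T"
      by (simp only:)
    then show ?thesis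
      using r by (simp add: field_simps r_def[symmetric])
  qed
qed

lemma op_norm_nonneg: "T \<in> bounded_ops S \<Longrightarrow> 0 \<le> op_norm S T"
  unfolding op_norm_def by (rule cSUP_upper2[OF bdd_above_op_norm, where x=0]) auto

lemma op_norm_triangle_diff:
  assumes "A \<in> bounded_ops S" "B \<in> bounded_ops S" "D \<in> bounded_ops S"
  shows "op_norm S (A - D) \<le> op_norm S (A - B) + op_norm S (B - D)"
proof (rule op_norm_le)
  fix \<xi> assume \<xi>: "\<xi> \<in> ell2 S"
  note AB = bounded_ops_diff[OF assms(1,2)] and BD = bounded_ops_diff[OF assms(2,3)]
  have "(A - D) \<xi> = (A - B) \<xi> + (B - D) \<xi>"
    by simp
  then show "ell2_norm S ((A - D) \<xi>) \<le> (op_norm S (A - B) + op_norm S (B - D)) * ell2_norm S \<xi>"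
    using ell2_norm_triangle[OF bounded_ops_ell2[OF AB \<xi>] bounded_ops_ell2[OF BD \<xi>]]
      ell2_norm_le_op_norm[OF AB \<xi>] ell2_norm_le_op_norm[OF BD \<xi>]
    by (simp add: distrib_right)
qed (intro add_nonneg_nonneg op_norm_nonneg bounded_ops_diff assms)

lemma op_norm_minus_commute: "op_norm S (A - B) = op_norm S (B - A)"
  by (simp add: op_norm_def ell2_norm_def norm_minus_commute)

lemma op_norm_le_0D:
  assumes "T \<in> bounded_ops S" "op_norm S T \<le> 0"
  shows "T = 0"
proof
  fix \<xi> show "T \<xi> = 0 \<xi>"
  proof (cases "\<xi> \<in> ell2 S")
    case True
    then have "ell2_norm S (T \<xi>) \<le> op_norm S T * ell2_norm S \<xi>"
      by (rule ell2_norm_le_op_norm[OF assms(1)])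
    also have "\<dots> \<le> 0" using assms(2) by (simp add: mult_nonpos_nonneg)
    finally show ?thesis
      using ell2_norm_eq_0D[OF bounded_ops_ell2[OF assms(1) True]] by simp
  next
    case False
    then show ?thesis using assms(1) by (simp add: bounded_ops_def)
  qed
qed

text \<open>Completeness of B(l2), with the limit built coordinatewise. It supplies the operator
  that the definite description in \<open>rho_ext\<close> refers to.\<close>

lemma bounded_ops_complete:
  assumes A: "\<And>n::nat. A n \<in> bounded_ops S"
    and cauchy: "\<And>e. e > 0 \<Longrightarrow> \<exists>N. \<forall>m\<ge>N. \<forall>n\<ge>N. op_norm S (A m - A n) < e"
  shows "\<exists>T\<in>bounded_ops S. (\<lambda>n. op_norm S (A n - T)) \<longlonglongrightarrow> 0"
proof -
  define T where "T \<xi> s = lim (\<lambda>n. A n \<xi> s)" for \<xi> s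
  have diff: "ell2_norm S (A m \<xi> - A n \<xi>) \<le> op_norm S (A m - A n) * ell2_norm S \<xi>"
    if "\<xi> \<in> ell2 S" for m n \<xi>
    using ell2_norm_le_op_norm[OF bounded_ops_diff[OF A A] that, of m n] by simp
  have lim: "(\<lambda>n. A n \<xi> s) \<longlonglongrightarrow> T \<xi> s" if \<xi>: "\<xi> \<in> ell2 S" for \<xi> s
  proof -
    have "Cauchy (\<lambda>n. A n \<xi> s)"
    proof (rule metric_CauchyI)
      fix e :: real assume "e > 0"
      let ?r = "ell2_norm S \<xi> + 1"
      have r: "?r > 0" by (simp add: add_nonneg_pos)
      then obtain N where N: "\<forall>m\<ge>N. \<forall>n\<ge>N. op_norm S (A m - A n) < e / ?r"
        using cauchy[of "e / ?r"] \<open>e > 0\<close> by auto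
      have "dist (A m \<xi> s) (A n \<xi> s) < e" if "m \<ge> N" "n \<ge> N" for m n
      proof -
        have "dist (A m \<xi> s) (A n \<xi> s) \<le> ell2_norm S (A m \<xi> - A n \<xi>)"
          using cmod_le_ell2_norm[OF ell2_diff[OF bounded_ops_ell2[OF A \<xi>] bounded_ops_ell2[OF A \<xi>]], of m n s]
          by (simp add: dist_norm)
        also have "\<dots> \<le> op_norm S (A m - A n) * ell2_norm S \<xi>"
          by (rule diff[OF \<xi>])
        also have "\<dots> \<le> op_norm S (A m - A n) * ?r"
          by (intro mult_left_mono op_norm_nonneg bounded_ops_diff A) auto
        also have "\<dots> < e"
          using N that r by (simp add: pos_less_divide_eq)
        finally show ?thesis .
      qed
      then show "\<exists>M. \<forall>m\<ge>M. \<forall>n\<ge>M. dist (A m \<xi> s) (A n \<xi> s) < e"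
        by blast
    qed
    then show ?thesis
      unfolding T_def using Cauchy_convergent_iff convergent_LIMSEQ_iff by blast
  qed
  \<comment> \<open>The bound for \<open>A n - A m\<close> on a finite set of coordinates survives
    the limit in m. Since the index N does not depend on \<xi>, coordinatewise convergence improves
    to convergence in operator norm.\<close>
  have close: "A n \<xi> - T \<xi> \<in> ell2 S \<and> ell2_norm S (A n \<xi> - T \<xi>) \<le> e * ell2_norm S \<xi>"
    if \<xi>: "\<xi> \<in> ell2 S" and N: "\<forall>m\<ge>N. \<forall>n\<ge>N. op_norm S (A m - A n) < e" and n: "n \<ge> N" for \<xi> N e n
  proof -
    have off: "(A n \<xi> - T \<xi>) s = 0" if "s \<notin> S" for s
    proof -
      have "(\<lambda>n. A n \<xi> s) = (\<lambda>n. 0)"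
        using ell2_outside[OF bounded_ops_ell2[OF A \<xi>] that] by simp
      then have "T \<xi> s = 0"
        using lim[OF \<xi>, of s] by (simp add: LIMSEQ_const_iff)
      then show ?thesis
        using ell2_outside[OF bounded_ops_ell2[OF A \<xi>] that] by simp
    qed
    have bd: "L2_set (\<lambda>s. cmod ((A n \<xi> - T \<xi>) s)) F \<le> e * ell2_norm S \<xi>"
      if F: "finite F" "F \<subseteq> S" for F
    proof (rule tendsto_upperbound)
      show "(\<lambda>m. L2_set (\<lambda>s. cmod (A n \<xi> s - A m \<xi> s)) F)
          \<longlonglongrightarrow> L2_set (\<lambda>s. cmod ((A n \<xi> - T \<xi>) s)) F"
        unfolding L2_set_def fun_diff_def
        by (intro tendsto_intros lim \<xi>)
      have "L2_set (\<lambda>s. cmod (A n \<xi> s - A m \<xi> s)) F \<le> e * ell2_norm S \<xi>" if "m \<ge> N" for m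
      proof -
        have "L2_set (\<lambda>s. cmod ((A n \<xi> - A m \<xi>) s)) F \<le> ell2_norm S (A n \<xi> - A m \<xi>)"
          by (intro L2_set_le_ell2_norm F ell2_diff bounded_ops_ell2[OF A \<xi>])
        also have "\<dots> \<le> op_norm S (A n - A m) * ell2_norm S \<xi>"
          by (rule diff[OF \<xi>])
        also have "\<dots> \<le> e * ell2_norm S \<xi>"
          using N n that by (intro mult_right_mono) (auto intro: less_imp_le)
        finally show ?thesis by simp
      qed
      then show "\<forall>\<^sub>F m in sequentially. L2_set (\<lambda>s. cmod (A n \<xi> s - A m \<xi> s)) F \<le> e * ell2_norm S \<xi>"
        by (auto simp: eventually_sequentially)
    qed simp
    show ?thesis
      by (rule conjI; rule ell2_bounded) (fact off bd)+
  qed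
  \<comment> \<open>Off \<open>ell2 S\<close> the value of \<open>lim\<close> is arbitrary, whereas
    members of \<open>bounded_ops\<close> must vanish there.\<close>
  define U where "U \<xi> = (if \<xi> \<in> ell2 S then T \<xi> else 0)" for \<xi>
  obtain N where N: "\<forall>m\<ge>N. \<forall>n\<ge>N. op_norm S (A m - A n) < 1"
    using cauchy[of 1] by auto
  obtain C where C: "\<forall>\<xi>\<in>ell2 S. ell2_norm S (A N \<xi>) \<le> C * ell2_norm S \<xi>"
    using A[of N] by (auto simp: bounded_ops_def)
  \<comment> \<open>Both terms on the right are known to lie in l2 with norm control, so T inherits
    membership and the constant \<open>C + 1\<close>.\<close>
  have T_eq: "T \<xi> = A N \<xi> - (A N \<xi> - T \<xi>)" for \<xi>
    by simp
  have T_ell2: "T \<xi> \<in> ell2 S" if "\<xi> \<in> ell2 S" for \<xi>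
    using ell2_diff[OF bounded_ops_ell2[OF A that] conjunct1[OF close[OF that N order_refl]], of N]
      T_eq[of \<xi>] by simp
  have "U \<in> bounded_ops S"
    unfolding bounded_ops_def
  proof (intro CollectI conjI ballI allI impI)
    show "\<exists>C. \<forall>\<xi>\<in>ell2 S. ell2_norm S (U \<xi>) \<le> C * ell2_norm S \<xi>"
    proof (intro exI ballI)
      fix \<xi> assume \<xi>: "\<xi> \<in> ell2 S"
      have "ell2_norm S (T \<xi>) \<le> ell2_norm S (A N \<xi>) + ell2_norm S (A N \<xi> - T \<xi>)"
        using ell2_norm_triangle_diff[OF bounded_ops_ell2[OF A \<xi>]
            conjunct1[OF close[OF \<xi> N order_refl]], of N] T_eq[of \<xi>] by simp
      then show "ell2_norm S (U \<xi>) \<le> (C + 1) * ell2_norm S \<xi>"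
        using bspec[OF C \<xi>] conjunct2[OF close[OF \<xi> N order_refl]] \<xi>
        by (simp add: U_def algebra_simps)
    qed
    fix \<xi> assume \<xi>: "\<xi> \<in> ell2 S"
    show "U (\<xi> + \<eta>) = U \<xi> + U \<eta>" if \<eta>: "\<eta> \<in> ell2 S" for \<eta>
    proof
      fix s
      have "A n (\<xi> + \<eta>) s = A n \<xi> s + A n \<eta> s" for n
        using A[of n] \<xi> \<eta> by (simp add: bounded_ops_def)
      then have "(\<lambda>n. A n (\<xi> + \<eta>) s) \<longlonglongrightarrow> T \<xi> s + T \<eta> s"
        using tendsto_add[OF lim[OF \<xi>, of s] lim[OF \<eta>, of s]] by presburger
      then have "T (\<xi> + \<eta>) s = T \<xi> s + T \<eta> s"
        by (rule LIMSEQ_unique[OF lim[OF ell2_add[OF \<xi> \<eta>]]])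
      then show "U (\<xi> + \<eta>) s = (U \<xi> + U \<eta>) s"
        using \<xi> \<eta> by (simp add: U_def ell2_add)
    qed
    show "U (\<lambda>s. c * \<xi> s) = (\<lambda>s. c * U \<xi> s)" for c
    proof
      fix s
      have "A n (\<lambda>s. c * \<xi> s) s = c * A n \<xi> s" for n
        using A[of n] \<xi> by (simp add: bounded_ops_def)
      then have "(\<lambda>n. A n (\<lambda>s. c * \<xi> s) s) \<longlonglongrightarrow> c * T \<xi> s"
        using tendsto_mult_left[OF lim[OF \<xi>, of s], of c] by presburger
      then have "T (\<lambda>s. c * \<xi> s) s = c * T \<xi> s"
        by (rule LIMSEQ_unique[OF lim[OF ell2_scale[OF \<xi>]]])
      then show "U (\<lambda>s. c * \<xi> s) s = c * U \<xi> s"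
        using \<xi> by (simp add: U_def ell2_scale)
    qed
  qed (auto simp: U_def T_ell2)
  moreover have "(\<lambda>n. op_norm S (A n - U)) \<longlonglongrightarrow> 0"
  proof (rule LIMSEQ_I)
    fix e :: real assume "e > 0"
    then obtain N where N: "\<forall>m\<ge>N. \<forall>n\<ge>N. op_norm S (A m - A n) < e / 2"
      using cauchy[of "e / 2"] by auto
    have "norm (op_norm S (A n - U) - 0) < e" if "n \<ge> N" for n
    proof -
      have "op_norm S (A n - U) \<le> e / 2"
        using close[OF _ N that] \<open>e > 0\<close> by (intro op_norm_le) (auto simp: U_def)
      then show ?thesis
        using op_norm_nonneg[OF bounded_ops_diff[OF A \<open>U \<in> bounded_ops S\<close>], of n] \<open>e > 0\<close> by simp
    qed
    then show "\<exists>N. \<forall>n\<ge>N. norm (op_norm S (A n - U) - 0) < e" by blast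
  qed
  ultimately show ?thesis by blast
qed

section \<open>The regular representations on compactly supported functions\<close>

context groupoid
begin

section \<open>Arrow algebra on a source fibre and the matrix form of \<open>rho\<close>\<close>

lemma unit_spaceD:
  assumes "u \<in> unit_space G"
  shows "u \<in> arrows G" "gsrc G u = u" "grng G u = u"
  using assms by (auto simp: unit_space_def)

lemma composable_iff:
  "(g, h) \<in> composable G \<longleftrightarrow> g \<in> arrows G \<and> h \<in> arrows G \<and> gsrc G g = grng G h"
  by (simp add: composable_def)

lemma mult_inv_composable:
  assumes "g \<in> src_fibre G u" "p \<in> src_fibre G u"
  shows "(g, ginv G p) \<in> composable G"
  using assms by (simp add: src_fibre_def composable_iff inv_closed rng_inv)

lemma
  assumes "g \<in> src_fibre G u" "p \<in> src_fibre G u"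
  shows mult_inv_closed: "gmult G g (ginv G p) \<in> arrows G"
    and rng_mult_inv: "grng G (gmult G g (ginv G p)) = grng G g"
    and src_mult_inv: "gsrc G (gmult G g (ginv G p)) = grng G p"
    and mult_inv_cancel: "gmult G (gmult G g (ginv G p)) p = g"
proof -
  note c = mult_inv_composable[OF assms]
  show "gmult G g (ginv G p) \<in> arrows G" "grng G (gmult G g (ginv G p)) = grng G g"
    "gsrc G (gmult G g (ginv G p)) = grng G p"
    using c assms by (simp_all add: mult_closed rng_mult src_mult src_inv src_fibre_def)
  have "(ginv G p, p) \<in> composable G"
    using assms by (simp add: src_fibre_def composable_iff inv_closed src_inv)
  then have "gmult G (gmult G g (ginv G p)) p = gmult G g (gmult G (ginv G p) p)"
    by (rule mult_assoc[OF c])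
  also have "\<dots> = g"
    using assms mult_src[of g] by (simp add: src_fibre_def inv_mult)
  finally show "gmult G (gmult G g (ginv G p)) p = g" .
qed

lemma inv_mult_inv_mult:
  assumes g: "g \<in> src_fibre G u" and p: "p \<in> src_fibre G u"
  shows "gmult G (ginv G (gmult G g (ginv G p))) g = p"
proof -
  let ?h = "gmult G g (ginv G p)"
  note h = mult_inv_closed[OF g p] src_mult_inv[OF g p]
  have pa: "p \<in> arrows G" using p by (simp add: src_fibre_def)
  have "gmult G (ginv G ?h) g = gmult G (ginv G ?h) (gmult G ?h p)"
    by (simp add: mult_inv_cancel[OF g p])
  also have "\<dots> = gmult G (gmult G (ginv G ?h) ?h) p"
    using h pa by (intro mult_assoc[symmetric]) (simp_all add: composable_iff inv_closed src_inv)
  also have "\<dots> = p"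
    using h pa by (simp add: inv_mult rng_mult_self)
  finally show ?thesis .
qed

text \<open>The change of variables h = g p^-1, with inverse p = h^-1 g. It moves the convolution
  sum from a range fibre to the source fibre that indexes the l2 space.\<close>

lemma bij_betw_mult_inv:
  assumes g: "g \<in> src_fibre G u"
  shows "bij_betw (\<lambda>p. gmult G g (ginv G p)) (src_fibre G u) (rng_fibre G (grng G g))"
proof (rule bij_betw_byWitness[where f'="\<lambda>h. gmult G (ginv G h) g"])
  show "\<forall>p\<in>src_fibre G u. gmult G (ginv G (gmult G g (ginv G p))) g = p"
    using inv_mult_inv_mult[OF g] by blast
  show "\<forall>h\<in>rng_fibre G (grng G g). gmult G g (ginv G (gmult G (ginv G h) g)) = h"
  proof
    fix h assume h: "h \<in> rng_fibre G (grng G g)"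
    let ?k = "gmult G (ginv G h) g"
    have ga: "g \<in> arrows G" and ha: "h \<in> arrows G" and hr: "grng G h = grng G g"
      using g h by (auto simp: src_fibre_def rng_fibre_def)
    have c: "(ginv G h, g) \<in> composable G" "(h, ginv G h) \<in> composable G"
      using ga ha hr by (simp_all add: composable_iff inv_closed src_inv rng_inv)
    have k: "?k \<in> arrows G" "grng G ?k = gsrc G h" "gsrc G ?k = gsrc G g"
      using c ga ha by (simp_all add: mult_closed rng_mult src_mult rng_inv)
    have "gmult G h ?k = gmult G (gmult G h (ginv G h)) g"
      by (rule mult_assoc[OF c(2,1), symmetric])
    also have "\<dots> = g"
      using ga ha hr by (simp add: mult_inv rng_mult_self)
    finally have "gmult G g (ginv G ?k) = gmult G (gmult G h ?k) (ginv G ?k)"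
      by simp
    also have "\<dots> = gmult G h (gmult G ?k (ginv G ?k))"
      using k ha by (intro mult_assoc) (simp_all add: composable_iff inv_closed rng_inv)
    also have "\<dots> = h"
      using k ha mult_src[of h] by (simp add: mult_inv)
    finally show "gmult G g (ginv G ?k) = h" .
  qed
  show "(\<lambda>p. gmult G g (ginv G p)) ` src_fibre G u \<subseteq> rng_fibre G (grng G g)"
    using g by (auto simp: rng_fibre_def mult_inv_closed rng_mult_inv)
  show "(\<lambda>h. gmult G (ginv G h) g) ` rng_fibre G (grng G g) \<subseteq> src_fibre G u"
    using g by (auto simp: rng_fibre_def src_fibre_def composable_iff mult_closed src_mult inv_closed src_inv)
qed

text \<open>In this form the operator has matrix entry f(g p^-1) in row g and column p. Operators
  over different units are compared through these entries.\<close>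

lemma rho_eq:
  assumes "\<xi> \<in> ell2 (src_fibre G u)" "g \<in> src_fibre G u"
  shows "rho G u f \<xi> g = (\<Sum>\<^sub>\<infinity>p\<in>src_fibre G u. f (gmult G g (ginv G p)) * \<xi> p)"
proof -
  note bij = bij_betw_mult_inv[OF assms(2)]
  have "(\<Sum>\<^sub>\<infinity>p\<in>src_fibre G u. f (gmult G g (ginv G p)) * \<xi> p)
      = (\<Sum>\<^sub>\<infinity>p\<in>src_fibre G u. f (gmult G g (ginv G p)) * \<xi> (gmult G (ginv G (gmult G g (ginv G p))) g))"
    by (intro infsum_cong) (simp add: inv_mult_inv_mult[OF assms(2)])
  also have "\<dots> = (\<Sum>\<^sub>\<infinity>h\<in>rng_fibre G (grng G g). f h * \<xi> (gmult G (ginv G h) g))"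
    by (rule infsum_reindex_bij_betw[OF bij])
  finally show ?thesis
    using assms by (simp add: rho_def)
qed

lemma rho_outside:
  "\<xi> \<notin> ell2 (src_fibre G u) \<Longrightarrow> rho G u f \<xi> = 0"
  "g \<notin> src_fibre G u \<Longrightarrow> rho G u f \<xi> g = 0"
  by (auto simp: rho_def)

section \<open>Uniform boundedness of the regular representations\<close>

text \<open>This makes each row of the matrix f(g p^-1) finite, so the \<open>infsum\<close> in
  \<open>rho\<close> is a finite sum and is additive in f and in the vector.\<close>

definition finite_on_fibres :: "('g \<Rightarrow> complex) \<Rightarrow> bool" where
  "finite_on_fibres f \<longleftrightarrow> (\<forall>u\<in>unit_space G. finite {h \<in> rng_fibre G u. f h \<noteq> 0})"

text \<open>One constant serves all units at once, which keeps the real supremum in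
  \<open>red_norm\<close> finite. Finiteness on fibres is bundled in so that the property is stable
  under sums.\<close>

definition uniformly_bounded :: "('g \<Rightarrow> complex) \<Rightarrow> bool" where
  "uniformly_bounded f \<longleftrightarrow> finite_on_fibres f \<and>
     (\<exists>C\<ge>0. \<forall>u\<in>unit_space G. \<forall>\<xi>\<in>ell2 (src_fibre G u).
        rho G u f \<xi> \<in> ell2 (src_fibre G u) \<and>
        ell2_norm (src_fibre G u) (rho G u f \<xi>) \<le> C * ell2_norm (src_fibre G u) \<xi>)"

text \<open>The map p to g p^-1 embeds the nonzero entries of row g into the support of f on the
  range fibre of r(g).\<close>

lemma finite_kernel_row:
  assumes "finite_on_fibres f" "g \<in> src_fibre G u"
  shows "finite {p \<in> src_fibre G u. f (gmult G g (ginv G p)) \<noteq> 0}"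
proof (rule inj_on_finite)
  show "inj_on (\<lambda>p. gmult G g (ginv G p)) {p \<in> src_fibre G u. f (gmult G g (ginv G p)) \<noteq> 0}"
    using bij_betw_imp_inj_on[OF bij_betw_mult_inv[OF assms(2)]] by (rule inj_on_subset) auto
  show "(\<lambda>p. gmult G g (ginv G p)) ` {p \<in> src_fibre G u. f (gmult G g (ginv G p)) \<noteq> 0}
      \<subseteq> {h \<in> rng_fibre G (grng G g). f h \<noteq> 0}"
    using bij_betw_imp_surj_on[OF bij_betw_mult_inv[OF assms(2)]] by auto
  show "finite {h \<in> rng_fibre G (grng G g). f h \<noteq> 0}"
    using assms rng_unit by (auto simp: finite_on_fibres_def src_fibre_def)
qed

lemma summable_kernel_row:
  assumes "finite_on_fibres f" "g \<in> src_fibre G u"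
  shows "(\<lambda>p. f (gmult G g (ginv G p)) * \<xi> p) summable_on src_fibre G u"
  by (rule finite_nonzero_values_imp_summable_on)
    (rule finite_subset[OF _ finite_kernel_row[OF assms]], auto)

lemma rho_add:
  assumes "finite_on_fibres f" "finite_on_fibres f'"
  shows "rho G u (\<lambda>h. f h + f' h) \<xi> = rho G u f \<xi> + rho G u f' \<xi>"
proof
  fix g
  show "rho G u (\<lambda>h. f h + f' h) \<xi> g = (rho G u f \<xi> + rho G u f' \<xi>) g"
  proof (cases "\<xi> \<in> ell2 (src_fibre G u) \<and> g \<in> src_fibre G u")
    case True
    then show ?thesis
      using infsum_add[OF summable_kernel_row[OF assms(1)] summable_kernel_row[OF assms(2)], of g u g \<xi> \<xi>]
      by (simp add: rho_eq distrib_right)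
  qed (auto simp: rho_outside)
qed

lemma rho_scale: "rho G u (\<lambda>h. c * f h) \<xi> = (\<lambda>g. c * rho G u f \<xi> g)"
proof
  fix g
  show "rho G u (\<lambda>h. c * f h) \<xi> g = c * rho G u f \<xi> g"
  proof (cases "\<xi> \<in> ell2 (src_fibre G u) \<and> g \<in> src_fibre G u")
    case True
    then show ?thesis
      by (simp add: rho_eq mult.assoc infsum_cmult_right')
  qed (auto simp: rho_outside)
qed

lemma finite_on_fibres_add:
  assumes "finite_on_fibres f" "finite_on_fibres f'"
  shows "finite_on_fibres (\<lambda>h. f h + f' h)"
  unfolding finite_on_fibres_def
proof
  fix u assume "u \<in> unit_space G"
  then have "finite ({h \<in> rng_fibre G u. f h \<noteq> 0} \<union> {h \<in> rng_fibre G u. f' h \<noteq> 0})"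
    using assms by (simp add: finite_on_fibres_def)
  then show "finite {h \<in> rng_fibre G u. f h + f' h \<noteq> 0}"
    by (rule rev_finite_subset) auto
qed

lemma uniformly_bounded_add:
  assumes "uniformly_bounded f" "uniformly_bounded f'"
  shows "uniformly_bounded (\<lambda>h. f h + f' h)"
proof -
  obtain C where C: "C \<ge> 0" "\<And>u \<xi>. u\<in>unit_space G \<Longrightarrow> \<xi>\<in>ell2 (src_fibre G u) \<Longrightarrow>
        rho G u f \<xi> \<in> ell2 (src_fibre G u) \<and>
        ell2_norm (src_fibre G u) (rho G u f \<xi>) \<le> C * ell2_norm (src_fibre G u) \<xi>"
    using assms(1) unfolding uniformly_bounded_def by blast
  obtain D where D: "D \<ge> 0" "\<And>u \<xi>. u\<in>unit_space G \<Longrightarrow> \<xi>\<in>ell2 (src_fibre G u) \<Longrightarrow>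
        rho G u f' \<xi> \<in> ell2 (src_fibre G u) \<and>
        ell2_norm (src_fibre G u) (rho G u f' \<xi>) \<le> D * ell2_norm (src_fibre G u) \<xi>"
    using assms(2) unfolding uniformly_bounded_def by blast
  have fin: "finite_on_fibres f" "finite_on_fibres f'"
    using assms by (auto simp: uniformly_bounded_def)
  show ?thesis
    unfolding uniformly_bounded_def
  proof (intro conjI exI ballI finite_on_fibres_add fin)
    show "0 \<le> C + D" using C(1) D(1) by simp
    fix u \<xi> assume u: "u \<in> unit_space G" and \<xi>: "\<xi> \<in> ell2 (src_fibre G u)"
    note C' = C(2)[OF u \<xi>] and D' = D(2)[OF u \<xi>]
    show "rho G u (\<lambda>h. f h + f' h) \<xi> \<in> ell2 (src_fibre G u)"
      unfolding rho_add[OF fin] using C' D' by (blast intro: ell2_add)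
    show "ell2_norm (src_fibre G u) (rho G u (\<lambda>h. f h + f' h) \<xi>)
        \<le> (C + D) * ell2_norm (src_fibre G u) \<xi>"
      unfolding rho_add[OF fin] distrib_right
      using ell2_norm_triangle[of "rho G u f \<xi>" _ "rho G u f' \<xi>"] C' D' by force
  qed
qed

lemma uniformly_bounded_scale:
  assumes "uniformly_bounded f"
  shows "uniformly_bounded (\<lambda>h. c * f h)"
proof -
  obtain C where C: "C \<ge> 0" "\<And>u \<xi>. u\<in>unit_space G \<Longrightarrow> \<xi>\<in>ell2 (src_fibre G u) \<Longrightarrow>
        rho G u f \<xi> \<in> ell2 (src_fibre G u) \<and>
        ell2_norm (src_fibre G u) (rho G u f \<xi>) \<le> C * ell2_norm (src_fibre G u) \<xi>"
    and fin: "finite_on_fibres f"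
    using assms unfolding uniformly_bounded_def by blast
  have "finite_on_fibres (\<lambda>h. c * f h)"
    unfolding finite_on_fibres_def
  proof
    fix u assume "u \<in> unit_space G"
    then have "finite {h \<in> rng_fibre G u. f h \<noteq> 0}"
      using fin by (simp add: finite_on_fibres_def)
    then show "finite {h \<in> rng_fibre G u. c * f h \<noteq> 0}"
      by (rule rev_finite_subset) auto
  qed
  moreover have "rho G u (\<lambda>h. c * f h) \<xi> \<in> ell2 (src_fibre G u) \<and>
      ell2_norm (src_fibre G u) (rho G u (\<lambda>h. c * f h) \<xi>)
        \<le> (cmod c * C) * ell2_norm (src_fibre G u) \<xi>"
    if "u \<in> unit_space G" "\<xi> \<in> ell2 (src_fibre G u)" for u \<xi>
    using C(2)[OF that] mult_left_mono[OF conjunct2[OF C(2)[OF that]], of "cmod c"]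
    by (simp add: rho_scale ell2_scale ell2_norm_scale mult.assoc)
  moreover have "0 \<le> cmod c * C"
    using C(1) by simp
  ultimately show ?thesis
    unfolding uniformly_bounded_def by blast
qed

text \<open>If source and range are injective on B, the matrix f(g p^-1) has at most one nonzero
  entry in each row and each column. It is a weighted partial permutation, so its norm is at most
  the bound M on the weights.\<close>

lemma uniformly_bounded_bisection:
  assumes B: "inj_on (gsrc G) B" "inj_on (grng G) B"
    and f: "\<And>h. h \<notin> B \<Longrightarrow> f h = 0" "\<And>h. cmod (f h) \<le> M"
  shows "uniformly_bounded f"
proof -
  have M: "0 \<le> M" by (rule order_trans[OF norm_ge_zero f(2)])
  have fin: "finite_on_fibres f"
    unfolding finite_on_fibres_def
  proof
    fix u
    show "finite {h \<in> rng_fibre G u. f h \<noteq> 0}"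
    proof (rule inj_on_finite)
      show "inj_on (grng G) {h \<in> rng_fibre G u. f h \<noteq> 0}"
        by (rule inj_on_subset[OF B(2)]) (use f(1) in blast)
      show "grng G ` {h \<in> rng_fibre G u. f h \<noteq> 0} \<subseteq> {u}"
        by (auto simp: rng_fibre_def)
    qed simp
  qed
  have "rho G u f \<xi> \<in> ell2 (src_fibre G u) \<and>
      ell2_norm (src_fibre G u) (rho G u f \<xi>) \<le> M * ell2_norm (src_fibre G u) \<xi>"
    if \<xi>: "\<xi> \<in> ell2 (src_fibre G u)" for u \<xi>
  proof -
    \<comment> \<open>D consists of the rows with an entry indexed by B, and \<open>\<pi> g\<close>
      is the column of that entry.\<close>
    define D where "D = {g \<in> src_fibre G u. \<exists>p\<in>src_fibre G u. gmult G g (ginv G p) \<in> B}"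
    define \<pi> where "\<pi> g = (SOME p. p \<in> src_fibre G u \<and> gmult G g (ginv G p) \<in> B)" for g
    have \<pi>: "\<pi> g \<in> src_fibre G u" "gmult G g (ginv G (\<pi> g)) \<in> B" if "g \<in> D" for g
      using someI_ex[of "\<lambda>p. p \<in> src_fibre G u \<and> gmult G g (ginv G p) \<in> B"] that
      by (auto simp: D_def \<pi>_def)
    \<comment> \<open>All entries of row g are indexed by arrows with range r(g), so injectivity of
      the range map on B leaves one of them.\<close>
    have \<pi>_unique: "p = \<pi> g"
      if g: "g \<in> src_fibre G u" and p: "p \<in> src_fibre G u" and pB: "gmult G g (ginv G p) \<in> B" for g p
    proof -
      have "g \<in> D" using g p pB by (auto simp: D_def)
      then have "gmult G g (ginv G p) = gmult G g (ginv G (\<pi> g))"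
        using inj_onD[OF B(2) _ pB \<pi>(2)] rng_mult_inv[OF g p] rng_mult_inv[OF g \<pi>(1)] by metis
      then show ?thesis
        by (rule inj_onD[OF bij_betw_imp_inj_on[OF bij_betw_mult_inv[OF g]] _ p \<pi>(1)[OF \<open>g \<in> D\<close>]])
    qed
    \<comment> \<open>Entries of column p are indexed by arrows with source r(p), so here
      injectivity of the source map on B decides.\<close>
    have \<pi>_inj: "inj_on \<pi> D"
    proof (rule inj_onI)
      fix g g' assume g: "g \<in> D" and g': "g' \<in> D" and eq: "\<pi> g = \<pi> g'"
      have u: "g \<in> src_fibre G u" "g' \<in> src_fibre G u"
        using g g' by (auto simp: D_def)
      have "gmult G g (ginv G (\<pi> g)) = gmult G g' (ginv G (\<pi> g))"
        using src_mult_inv[OF u(1) \<pi>(1)[OF g]] src_mult_inv[OF u(2) \<pi>(1)[OF g']]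
          inj_onD[OF B(1) _ \<pi>(2)[OF g] \<pi>(2)[OF g']] unfolding eq by metis
      then have "gmult G (gmult G g (ginv G (\<pi> g))) (\<pi> g) = gmult G (gmult G g' (ginv G (\<pi> g))) (\<pi> g)"
        by (rule arg_cong)
      then show "g = g'"
        unfolding mult_inv_cancel[OF u(1) \<pi>(1)[OF g]] mult_inv_cancel[OF u(2) \<pi>(1)[OF g]] .
    qed
    have val: "rho G u f \<xi> g = (if g \<in> D then f (gmult G g (ginv G (\<pi> g))) * \<xi> (\<pi> g) else 0)"
      if g: "g \<in> src_fibre G u" for g
    proof (cases "g \<in> D")
      case True
      have "(\<Sum>\<^sub>\<infinity>p\<in>src_fibre G u. f (gmult G g (ginv G p)) * \<xi> p)
          = (\<Sum>\<^sub>\<infinity>p\<in>{\<pi> g}. f (gmult G g (ginv G p)) * \<xi> p)"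
      proof (rule infsum_cong_neutral)
        fix p assume "p \<in> src_fibre G u - {\<pi> g}"
        then have "gmult G g (ginv G p) \<notin> B"
          using \<pi>_unique[OF g] by blast
        then show "f (gmult G g (ginv G p)) * \<xi> p = 0"
          by (simp add: f(1))
      qed (use \<pi>(1)[OF True] in auto)
      then show ?thesis
        using True by (simp add: rho_eq[OF \<xi> g])
    next
      case False
      then have "f (gmult G g (ginv G p)) = 0" if "p \<in> src_fibre G u" for p
        using that g f(1) by (auto simp: D_def)
      then show ?thesis
        using False by (simp add: rho_eq[OF \<xi> g] infsum_0)
    qed
    have bd: "L2_set (\<lambda>g. cmod (rho G u f \<xi> g)) F \<le> M * ell2_norm (src_fibre G u) \<xi>"
      if F: "finite F" "F \<subseteq> src_fibre G u" for F
    proof -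
      have "rho G u f \<xi> g = 0" if "g \<in> F - F \<inter> D" for g
        using val[of g] F(2) that by auto
      then have "L2_set (\<lambda>g. cmod (rho G u f \<xi> g)) F = L2_set (\<lambda>g. cmod (rho G u f \<xi> g)) (F \<inter> D)"
        unfolding L2_set_def using F(1)
        by (intro arg_cong[where f=sqrt] sum.mono_neutral_right) simp_all
      also have "\<dots> \<le> L2_set (\<lambda>g. M * cmod (\<xi> (\<pi> g))) (F \<inter> D)"
      proof (rule L2_set_mono)
        fix g assume g: "g \<in> F \<inter> D"
        then have "rho G u f \<xi> g = f (gmult G g (ginv G (\<pi> g))) * \<xi> (\<pi> g)"
          using val[of g] F(2) by auto
        then show "cmod (rho G u f \<xi> g) \<le> M * cmod (\<xi> (\<pi> g))"
          by (simp add: norm_mult mult_right_mono f(2))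
      qed simp
      also have "\<dots> = M * L2_set (\<lambda>g. cmod (\<xi> (\<pi> g))) (F \<inter> D)"
        by (rule L2_set_right_distrib[OF M, symmetric])
      \<comment> \<open>As \<pi> is injective, no coordinate of \<xi> is counted twice.\<close>
      also have "L2_set (\<lambda>g. cmod (\<xi> (\<pi> g))) (F \<inter> D) = L2_set (\<lambda>g. cmod (\<xi> g)) (\<pi> ` (F \<inter> D))"
        unfolding L2_set_def
        by (subst sum.reindex[OF inj_on_subset[OF \<pi>_inj]]) auto
      also have "M * \<dots> \<le> M * ell2_norm (src_fibre G u) \<xi>"
        using F(1) \<pi>(1) by (intro mult_left_mono L2_set_le_ell2_norm M \<xi>) blast+
      finally show ?thesis .
    qed
    show ?thesis
      using ell2_bounded[of "src_fibre G u" "rho G u f \<xi>" "M * ell2_norm (src_fibre G u) \<xi>"] bd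
        rho_outside(2) by blast
  qed
  then show ?thesis
    unfolding uniformly_bounded_def using fin M by blast
qed

text \<open>Induction on the cover, splitting f into its restriction to one bisection and the rest.
  The cut-offs may be discontinuous, which is harmless because \<open>uniformly_bounded\<close> does
  not speak of continuity.\<close>

lemma uniformly_bounded_finite_cover:
  assumes "finite \<B>" "\<And>B. B \<in> \<B> \<Longrightarrow> inj_on (gsrc G) B \<and> inj_on (grng G) B"
    and "\<And>h. h \<notin> \<Union>\<B> \<Longrightarrow> f h = 0" "\<And>h. cmod (f h) \<le> M"
  shows "uniformly_bounded f"
  using assms
proof (induction \<B> arbitrary: f rule: finite_induct)
  case empty
  then show ?case
    by (intro uniformly_bounded_bisection[where B="{}" and M=M]) auto
next
  case (insert B \<B>)
  have M: "0 \<le> M" by (rule order_trans[OF norm_ge_zero insert.prems(3)])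
  have "uniformly_bounded (\<lambda>h. if h \<in> B then f h else 0)"
    by (rule uniformly_bounded_bisection[where B=B and M=M]) (use insert.prems M in auto)
  moreover have "uniformly_bounded (\<lambda>h. if h \<in> B then 0 else f h)"
    by (rule insert.IH) (use insert.prems M in auto)
  ultimately have "uniformly_bounded (\<lambda>h. (if h \<in> B then f h else 0) + (if h \<in> B then 0 else f h))"
    by (rule uniformly_bounded_add)
  then show ?case
    by (simp add: if_distrib cong: if_cong)
qed

lemma rho_bounded_ops:
  assumes "uniformly_bounded f" "u \<in> unit_space G"
  shows "rho G u f \<in> bounded_ops (src_fibre G u)"
proof -
  have fin: "finite_on_fibres f"
    using assms by (simp add: uniformly_bounded_def)
  have "rho G u f (\<xi> + \<eta>) = rho G u f \<xi> + rho G u f \<eta>"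
    if "\<xi> \<in> ell2 (src_fibre G u)" "\<eta> \<in> ell2 (src_fibre G u)" for \<xi> \<eta>
  proof
    fix g
    show "rho G u f (\<xi> + \<eta>) g = (rho G u f \<xi> + rho G u f \<eta>) g"
    proof (cases "g \<in> src_fibre G u")
      case True
      have "(\<Sum>\<^sub>\<infinity>p\<in>src_fibre G u. f (gmult G g (ginv G p)) * (\<xi> + \<eta>) p)
          = (\<Sum>\<^sub>\<infinity>p\<in>src_fibre G u. f (gmult G g (ginv G p)) * \<xi> p + f (gmult G g (ginv G p)) * \<eta> p)"
        by (simp add: distrib_left)
      also have "\<dots> = (\<Sum>\<^sub>\<infinity>p\<in>src_fibre G u. f (gmult G g (ginv G p)) * \<xi> p)
          + (\<Sum>\<^sub>\<infinity>p\<in>src_fibre G u. f (gmult G g (ginv G p)) * \<eta> p)"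
        by (intro infsum_add summable_kernel_row fin True)
      finally show ?thesis
        using that ell2_add[OF that] True by (simp add: rho_eq)
    qed (simp add: rho_outside)
  qed
  moreover have "rho G u f (\<lambda>s. c * \<xi> s) = (\<lambda>s. c * rho G u f \<xi> s)"
    if "\<xi> \<in> ell2 (src_fibre G u)" for c \<xi>
  proof
    fix g
    show "rho G u f (\<lambda>s. c * \<xi> s) g = c * rho G u f \<xi> g"
      using that ell2_scale[OF that, of c]
      by (cases "g \<in> src_fibre G u")
        (simp_all add: rho_eq rho_outside mult.left_commute[of _ c] infsum_cmult_right')
  qed
  moreover obtain C where "\<And>\<xi>. \<xi> \<in> ell2 (src_fibre G u) \<Longrightarrow>
        rho G u f \<xi> \<in> ell2 (src_fibre G u) \<and>
        ell2_norm (src_fibre G u) (rho G u f \<xi>) \<le> C * ell2_norm (src_fibre G u) \<xi>"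
    using assms unfolding uniformly_bounded_def by blast
  ultimately show ?thesis
    unfolding bounded_ops_def using rho_outside(1) by blast
qed

text \<open>The constant common to all units bounds the operator norms from above, so the supremum
  defining \<open>red_norm\<close> really dominates each of them.\<close>

lemma op_norm_rho_le_red_norm:
  assumes "uniformly_bounded f" "u \<in> unit_space G"
  shows "op_norm (src_fibre G u) (rho G u f) \<le> red_norm G f"
proof -
  obtain C where C: "C \<ge> 0" "\<And>u \<xi>. u\<in>unit_space G \<Longrightarrow> \<xi>\<in>ell2 (src_fibre G u) \<Longrightarrow>
        ell2_norm (src_fibre G u) (rho G u f \<xi>) \<le> C * ell2_norm (src_fibre G u) \<xi>"
    using assms(1) unfolding uniformly_bounded_def by blast
  have "bdd_above ((\<lambda>u. op_norm (src_fibre G u) (rho G u f)) ` unit_space G)"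
    by (rule bdd_aboveI2[where M=C]) (intro op_norm_le C)
  then show ?thesis
    unfolding red_norm_def using assms(2) by (intro cSUP_upper)
qed

lemma
  assumes "uniformly_bounded f" "uniformly_bounded f'"
  shows uniformly_bounded_diff: "uniformly_bounded (f - f')"
    and rho_diff: "rho G u (f - f') = rho G u f - rho G u f'"
proof -
  have eq: "f - f' = (\<lambda>h. f h + (-1) * f' h)"
    by (simp add: fun_eq_iff)
  note s = uniformly_bounded_scale[OF assms(2), of "-1"]
  show "uniformly_bounded (f - f')"
    unfolding eq by (rule uniformly_bounded_add[OF assms(1) s])
  show "rho G u (f - f') = rho G u f - rho G u f'"
  proof
    fix \<xi>
    have "rho G u (f - f') \<xi> = rho G u f \<xi> + (\<lambda>g. (-1) * rho G u f' \<xi> g)"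
      unfolding eq using assms(1) s
      by (subst rho_add) (simp_all only: uniformly_bounded_def rho_scale)
    then show "rho G u (f - f') \<xi> = (rho G u f - rho G u f') \<xi>"
      by (simp add: fun_eq_iff)
  qed
qed

end

context etale_groupoid
begin

section \<open>Functions in \<open>Cc G\<close> are uniformly bounded\<close>

lemma bisection_neighbourhood:
  assumes "h \<in> arrows G"
  shows "\<exists>B. openin (gtop G) B \<and> h \<in> B \<and> inj_on (gsrc G) B \<and> inj_on (grng G) B"
proof -
  have inj: "\<exists>U. openin (gtop G) U \<and> h \<in> U \<and> inj_on f U"
    if "local_homeomorphism (gtop G) (subtopology (gtop G) (unit_space G)) f" for f
  proof -
    obtain U where U: "openin (gtop G) U" "h \<in> U"
      "homeomorphic_map (subtopology (gtop G) U) (subtopology (subtopology (gtop G) (unit_space G)) (f ` U)) f"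
      using \<open>h \<in> arrows G\<close> \<open>local_homeomorphism _ _ f\<close> unfolding local_homeomorphism_def arrows_def by blast
    have "topspace (subtopology (gtop G) U) = U"
      using openin_subset[OF U(1)] by auto
    then show ?thesis
      using homeomorphic_imp_injective_map[OF U(3)] U(1,2) by auto
  qed
  obtain U V where "openin (gtop G) U" "h \<in> U" "inj_on (gsrc G) U"
    "openin (gtop G) V" "h \<in> V" "inj_on (grng G) V"
    using inj[OF local_homeomorphism_src] inj[OF local_homeomorphism_rng] by blast
  then show ?thesis
    by (intro exI[of _ "U \<inter> V"]) (auto intro: inj_on_subset)
qed

text \<open>The support is closed in V and compact, but need not be closed in X when X is not
  Hausdorff. Later arguments therefore rely on compactness and on
  \<open>K \<subseteq> V\<close>.\<close>

lemma Cc_on_compact_support: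
  assumes "openin X V" "f \<in> Cc_on X V"
  obtains K where "compactin X K" "K \<subseteq> V" "\<And>h. h \<notin> K \<Longrightarrow> f h = 0"
proof -
  let ?K = "subtopology X V closure_of {g \<in> V. f g \<noteq> 0}"
  have K: "compactin X ?K" "?K \<subseteq> V"
    using assms by (auto simp: Cc_on_def compactin_subtopology)
  moreover have "{g \<in> V. f g \<noteq> 0} \<subseteq> ?K"
    using openin_subset[OF assms(1)] by (intro closure_of_subset) auto
  then have "f h = 0" if "h \<notin> ?K" for h
    using that assms(2) by (auto simp: Cc_on_def)
  ultimately show ?thesis
    using that by blast
qed

text \<open>Compactness of the support is used twice: f is bounded on it, and finitely many open
  bisections cover it.\<close>

lemma uniformly_bounded_Cc_on:
  assumes "openin (gtop G) V" "f \<in> Cc_on (gtop G) V"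
  shows "uniformly_bounded f"
proof -
  obtain K where K: "compactin (gtop G) K" "K \<subseteq> V" "\<And>h. h \<notin> K \<Longrightarrow> f h = 0"
    using Cc_on_compact_support[OF assms] by blast
  have "compactin euclidean (f ` K)"
    using assms(2) K by (intro image_compactin[of "subtopology (gtop G) V"])
      (auto simp: Cc_on_def compactin_subtopology)
  then have "bounded (f ` K)"
    by (simp add: compact_imp_bounded)
  then obtain M where M: "M \<ge> 0" "\<And>h. h \<in> K \<Longrightarrow> cmod (f h) \<le> M"
    unfolding bounded_pos by (metis imageI less_imp_le)
  let ?\<U> = "{B. openin (gtop G) B \<and> inj_on (gsrc G) B \<and> inj_on (grng G) B}"
  have "K \<subseteq> \<Union>?\<U>"
    using bisection_neighbourhood compactin_subset_topspace[OF K(1)] by (fastforce simp: arrows_def)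
  then obtain \<B> where \<B>: "finite \<B>" "\<B> \<subseteq> ?\<U>" "K \<subseteq> \<Union>\<B>"
    using compactinD[OF K(1), of ?\<U>] by auto
  show ?thesis
  proof (rule uniformly_bounded_finite_cover[OF \<B>(1)])
    show "cmod (f h) \<le> M" for h
      using M K(3) by (cases "h \<in> K") auto
    show "f h = 0" if "h \<notin> \<Union>\<B>" for h
      using that \<B>(3) K(3) by blast
  qed (use \<B> in auto)
qed

lemma uniformly_bounded_Cc:
  assumes "f \<in> Cc G"
  shows "uniformly_bounded f"
proof -
  obtain n :: nat and c u where
    u: "\<forall>k<n. \<exists>V. openin (gtop G) V \<and> Hausdorff_space (subtopology (gtop G) V) \<and>
        u k \<in> Cc_on (gtop G) V"
    and f: "f = (\<lambda>g. \<Sum>k<n. c k * u k g)"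
    using assms by (auto simp: Cc_def)
  have "uniformly_bounded (\<lambda>g. \<Sum>k<m. c k * u k g)" if "m \<le> n" for m
    using that
  proof (induction m)
    case 0
    show ?case
      by (rule uniformly_bounded_bisection[where B="{}" and M=0]) auto
  next
    case (Suc m)
    then have "uniformly_bounded (u m)"
      using u uniformly_bounded_Cc_on by (meson Suc_le_lessD)
    then have "uniformly_bounded (\<lambda>g. (\<Sum>k<m. c k * u k g) + c m * u m g)"
      using Suc by (intro uniformly_bounded_add uniformly_bounded_scale) auto
    then show ?case by simp
  qed
  then show ?thesis by (simp add: f)
qed

end

section \<open>Limits along a filter of units\<close>

lemma limitin_subfilter: "limitin X f l \<Phi> \<Longrightarrow> \<Psi> \<le> \<Phi> \<Longrightarrow> limitin X f l \<Psi>"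
  by (auto simp: limitin_def le_filter_def)

text \<open>The filter form of passing to a convergent subnet in a compact set. The limit h need not
  be unique, since X is not assumed Hausdorff.\<close>

lemma compactin_subfilter_limit:
  assumes K: "compactin X K" and \<Psi>: "\<Psi> \<noteq> bot" and z: "\<forall>\<^sub>F v in \<Psi>. z v \<in> K"
  obtains h \<Psi>' where "h \<in> K" "\<Psi>' \<le> \<Psi>" "\<Psi>' \<noteq> bot" "limitin X z h \<Psi>'"
proof -
  have "\<exists>h\<in>K. inf \<Psi> (filtercomap z (nhdsin X h)) \<noteq> bot"
  proof (rule ccontr)
    assume neg: "\<not> ?thesis"
    \<comment> \<open>If no point of K is a cluster point, each has an open neighbourhood that z
      eventually avoids. A finite subcover would make z eventually avoid K.\<close>
    let ?\<U> = "{S. openin X S \<and> (\<forall>\<^sub>F v in \<Psi>. z v \<notin> S)}"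
    have "K \<subseteq> \<Union>?\<U>"
    proof
      fix h assume h: "h \<in> K"
      then have hX: "h \<in> topspace X" using compactin_subset_topspace[OF K] by blast
      have "eventually (\<lambda>_. False) (inf \<Psi> (filtercomap z (nhdsin X h)))"
        using neg h by (simp add: trivial_limit_def)
      then obtain Q R where Q: "eventually Q \<Psi>" and R: "eventually R (filtercomap z (nhdsin X h))"
        and QR: "\<And>v. Q v \<Longrightarrow> R v \<Longrightarrow> False"
        by (auto simp: eventually_inf)
      obtain R' where R': "eventually R' (nhdsin X h)" "\<And>v. R' (z v) \<Longrightarrow> R v"
        using R by (auto simp: eventually_filtercomap)
      obtain S where S: "openin X S" "h \<in> S" "\<forall>s\<in>S. R' s"
        using R'(1) hX by (auto simp: eventually_nhdsin)
      have "\<forall>\<^sub>F v in \<Psi>. z v \<notin> S"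
        using Q by (rule eventually_mono) (use QR R'(2) S(3) in blast)
      then show "h \<in> \<Union>?\<U>" using S by blast
    qed
    then obtain \<F> where F: "finite \<F>" "\<F> \<subseteq> ?\<U>" "K \<subseteq> \<Union>\<F>"
      using compactinD[OF K, of ?\<U>] by auto
    have "\<forall>\<^sub>F v in \<Psi>. \<forall>S\<in>\<F>. z v \<notin> S"
      using F by (intro eventually_ball_finite) auto
    then have "\<forall>\<^sub>F v in \<Psi>. False"
      using z by eventually_elim (use F(3) in blast)
    then show False using \<Psi> by (simp add: trivial_limit_def)
  qed
  then obtain h where h: "h \<in> K" "inf \<Psi> (filtercomap z (nhdsin X h)) \<noteq> bot"
    by blast
  have hX: "h \<in> topspace X" using h compactin_subset_topspace[OF K] by blast
  have "limitin X z h (filtercomap z (nhdsin X h))"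
    unfolding limitin_def
  proof (intro conjI allI impI hX)
    fix U assume "openin X U \<and> h \<in> U"
    then have "\<forall>\<^sub>F s in nhdsin X h. s \<in> U"
      using hX by (auto simp: eventually_nhdsin)
    then show "\<forall>\<^sub>F v in filtercomap z (nhdsin X h). z v \<in> U"
      by (rule eventually_filtercomapI)
  qed
  then show ?thesis
    using that[OF h(1) _ h(2)] limitin_subfilter by (metis inf_le1 inf_le2)
qed

context etale_groupoid
begin

section \<open>Limits in the arrow space and local sections of the source map\<close>

lemma limitin_eventually_arrows: "limitin (gtop G) u a \<Phi> \<Longrightarrow> \<forall>\<^sub>F i in \<Phi>. u i \<in> arrows G"
  using limitinD[OF _ openin_topspace] limitin_topspace unfolding arrows_def by metis

lemma limitin_mult:
  assumes "limitin (gtop G) u a \<Phi>" "limitin (gtop G) v b \<Phi>"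
    and "\<forall>\<^sub>F i in \<Phi>. gsrc G (u i) = grng G (v i)" "gsrc G a = grng G b"
  shows "limitin (gtop G) (\<lambda>i. gmult G (u i) (v i)) (gmult G a b) \<Phi>"
proof -
  have "\<forall>\<^sub>F i in \<Phi>. (u i, v i) \<in> composable G"
    using limitin_eventually_arrows[OF assms(1)] limitin_eventually_arrows[OF assms(2)] assms(3)
    by eventually_elim (simp add: composable_iff)
  moreover have "(a, b) \<in> composable G"
    using limitin_topspace[OF assms(1)] limitin_topspace[OF assms(2)] assms(4)
    by (simp add: composable_iff arrows_def)
  moreover have "limitin (prod_topology (gtop G) (gtop G)) (\<lambda>i. (u i, v i)) (a, b) \<Phi>"
    using assms(1,2) by (simp add: limitin_pairwise o_def)
  ultimately have "limitin (subtopology (prod_topology (gtop G) (gtop G)) (composable G))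
      (\<lambda>i. (u i, v i)) (a, b) \<Phi>"
    by (simp add: limitin_subtopology)
  from continuous_map_limit[OF continuous_mult this] show ?thesis
    by (simp add: o_def)
qed

lemma limitin_inv:
  assumes "limitin (gtop G) u a \<Phi>"
  shows "limitin (gtop G) (\<lambda>i. ginv G (u i)) (ginv G a) \<Phi>"
  using continuous_map_limit[OF continuous_inv assms] by (simp add: o_def)

text \<open>Since r(u) = u u^-1, continuity of multiplication and inversion gives convergence of
  ranges directly in the topology of all arrows.\<close>

lemma limitin_rng:
  assumes "limitin (gtop G) u a \<Phi>"
  shows "limitin (gtop G) (\<lambda>i. grng G (u i)) (grng G a) \<Phi>"
proof -
  have a: "a \<in> arrows G" using limitin_topspace[OF assms] by (simp add: arrows_def)
  note ev = limitin_eventually_arrows[OF assms]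
  have "limitin (gtop G) (\<lambda>i. gmult G (u i) (ginv G (u i))) (gmult G a (ginv G a)) \<Phi>"
  proof (rule limitin_mult[OF assms limitin_inv[OF assms]])
    show "\<forall>\<^sub>F i in \<Phi>. gsrc G (u i) = grng G (ginv G (u i))"
      using ev by eventually_elim (simp add: rng_inv)
  qed (simp add: rng_inv a)
  moreover have "\<forall>\<^sub>F i in \<Phi>. gmult G (u i) (ginv G (u i)) = grng G (u i)"
    using ev by eventually_elim (rule mult_inv)
  ultimately have "limitin (gtop G) (\<lambda>i. grng G (u i)) (gmult G a (ginv G a)) \<Phi>"
    by (rule limitin_transform_eventually[rotated])
  then show ?thesis
    by (simp only: mult_inv[OF a])
qed

lemma limitin_src:
  assumes "limitin (gtop G) u a \<Phi>"
  shows "limitin (gtop G) (\<lambda>i. gsrc G (u i)) (gsrc G a) \<Phi>"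
proof -
  have a: "a \<in> arrows G" using limitin_topspace[OF assms] by (simp add: arrows_def)
  have ev: "\<forall>\<^sub>F i in \<Phi>. grng G (ginv G (u i)) = gsrc G (u i)"
    using limitin_eventually_arrows[OF assms] by eventually_elim (rule rng_inv)
  show ?thesis
    using limitin_transform_eventually[OF ev limitin_rng[OF limitin_inv[OF assms]]] a by (simp add: rng_inv)
qed

text \<open>A filter may have several limits in the arrow space; among units the Hausdorff property
  leaves only one.\<close>

lemma limitin_units_unique:
  assumes "limitin (gtop G) u a \<Phi>" "limitin (gtop G) u b \<Phi>" "\<Phi> \<noteq> bot"
    and "\<forall>\<^sub>F i in \<Phi>. u i \<in> unit_space G" "a \<in> unit_space G" "b \<in> unit_space G"
  shows "a = b"
  using assms by (intro limitin_Hausdorff_unique[OF _ _ _ Hausdorff_units, where f=u and F=\<Phi>])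
    (auto simp: limitin_subtopology)

text \<open>The section inverts the source map on a neighbourhood of a where that map is a
  homeomorphism onto an open set of units. Being total, \<alpha> has meaningful values only
  eventually along \<Phi>.\<close>

lemma local_section:
  assumes a: "a \<in> src_fibre G x"
    and lim: "limitin (gtop G) (\<lambda>v. v) x \<Phi>" and units: "\<forall>\<^sub>F v in \<Phi>. v \<in> unit_space G"
  obtains \<alpha> where "limitin (gtop G) \<alpha> a \<Phi>" "\<forall>\<^sub>F v in \<Phi>. \<alpha> v \<in> src_fibre G v"
proof -
  have aa: "a \<in> arrows G" "gsrc G a = x"
    using a by (auto simp: src_fibre_def)
  let ?X0 = "subtopology (gtop G) (unit_space G)"
  obtain U where U: "openin (gtop G) U" "a \<in> U" "openin ?X0 (gsrc G ` U)"
    and hom: "homeomorphic_map (subtopology (gtop G) U) (subtopology ?X0 (gsrc G ` U)) (gsrc G)"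
    using local_homeomorphism_src aa(1) unfolding local_homeomorphism_def arrows_def by blast
  have UX: "U \<subseteq> arrows G" using openin_subset[OF U(1)] by (simp add: arrows_def)
  have inj: "inj_on (gsrc G) U"
    using homeomorphic_imp_injective_map[OF hom] UX by (simp add: arrows_def inf.absorb2)
  have lim0: "limitin ?X0 (\<lambda>v. v) x \<Phi>"
    using lim units src_unit[OF aa(1)] aa(2) by (simp add: limitin_subtopology)
  define \<alpha> where "\<alpha> v = inv_into U (gsrc G) v" for v
  \<comment> \<open>The source map is open on U, so the image is a neighbourhood of x in the unit
    space. The case of general W gives convergence of \<alpha>, and \<open>W = U\<close> shows that
    \<alpha> eventually takes values in the right fibre.\<close>
  have ev: "\<forall>\<^sub>F v in \<Phi>. v \<in> gsrc G ` (W \<inter> U)" if W: "openin (gtop G) W" "a \<in> W" for W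
  proof -
    have "open_map (subtopology (gtop G) U) (subtopology ?X0 (gsrc G ` U)) (gsrc G)"
      using hom homeomorphic_imp_open_map by blast
    moreover have "openin (subtopology (gtop G) U) (W \<inter> U)"
      using W(1) by (auto simp: openin_subtopology)
    ultimately have "openin (subtopology ?X0 (gsrc G ` U)) (gsrc G ` (W \<inter> U))"
      unfolding open_map_def by blast
    then have "openin ?X0 (gsrc G ` (W \<inter> U))"
      using U(3) openin_trans_full by blast
    moreover have "x \<in> gsrc G ` (W \<inter> U)"
      using W(2) U(2) aa(2) by blast
    ultimately show ?thesis
      using limitinD[OF lim0] by blast
  qed
  have \<alpha>: "\<alpha> v \<in> W" if "v \<in> gsrc G ` (W \<inter> U)" for v W
    using that inj by (auto simp: \<alpha>_def)
  show ?thesis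
  proof (rule that)
    show "limitin (gtop G) \<alpha> a \<Phi>"
      unfolding limitin_def
    proof (intro conjI allI impI)
      show "a \<in> topspace (gtop G)" using aa by (simp add: arrows_def)
      fix W assume "openin (gtop G) W \<and> a \<in> W"
      then show "\<forall>\<^sub>F v in \<Phi>. \<alpha> v \<in> W"
        using ev[of W] \<alpha> by (auto elim: eventually_mono)
    qed
    have "\<forall>\<^sub>F v in \<Phi>. v \<in> gsrc G ` (U \<inter> U)"
      by (rule ev[OF U(1,2)])
    then show "\<forall>\<^sub>F v in \<Phi>. \<alpha> v \<in> src_fibre G v"
      by eventually_elim (use inj UX in \<open>auto simp: \<alpha>_def src_fibre_def\<close>)
  qed
qed

section \<open>Approximation of the fibre over \<open>x\<close> by nearby fibres\<close>

context
  fixes x :: 'a and \<Phi> :: "'a filter"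
  assumes lim: "limitin (gtop G) (\<lambda>v. v) x \<Phi>"
    and units: "\<forall>\<^sub>F v in \<Phi>. v \<in> unit_space G"
    and isotropy_limit: "\<And>\<Psi> g. \<Psi> \<le> \<Phi> \<Longrightarrow> \<Psi> \<noteq> bot \<Longrightarrow> limitin (gtop G) (\<lambda>v. v) g \<Psi> \<Longrightarrow>
      g \<in> isotropy G x \<Longrightarrow> g = x"
begin

text \<open>
  A limit \<open>h\<close> of the arrows \<open>\<alpha> v (\<beta> v)\<inverse>\<close> makes \<open>a\<inverse> h b\<close> a limit of the units
  \<open>v = (\<alpha> v)\<inverse> (\<alpha> v (\<beta> v)\<inverse>) (\<beta> v)\<close>.
\<close>

lemma section_quotient_limit:
  assumes a: "a \<in> src_fibre G x" "limitin (gtop G) \<alpha> a \<Phi>" "\<forall>\<^sub>F v in \<Phi>. \<alpha> v \<in> src_fibre G v"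
    and b: "b \<in> src_fibre G x" "limitin (gtop G) \<beta> b \<Phi>" "\<forall>\<^sub>F v in \<Phi>. \<beta> v \<in> src_fibre G v"
    and \<Psi>: "\<Psi> \<le> \<Phi>" "\<Psi> \<noteq> bot"
    and h: "limitin (gtop G) (\<lambda>v. gmult G (\<alpha> v) (ginv G (\<beta> v))) h \<Psi>"
  shows "h = gmult G a (ginv G b)"
proof -
  let ?z = "\<lambda>v. gmult G (\<alpha> v) (ginv G (\<beta> v))"
  note \<alpha>lim = limitin_subfilter[OF a(2) \<Psi>(1)] and \<beta>lim = limitin_subfilter[OF b(2) \<Psi>(1)]
  have ev: "\<forall>\<^sub>F v in \<Psi>. \<alpha> v \<in> src_fibre G v \<and> \<beta> v \<in> src_fibre G v \<and> v \<in> unit_space G"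
    using filter_leD[OF \<Psi>(1) a(3)] filter_leD[OF \<Psi>(1) b(3)] filter_leD[OF \<Psi>(1) units]
    by eventually_elim simp
  then have z: "\<forall>\<^sub>F v in \<Psi>. ?z v \<in> arrows G \<and> grng G (?z v) = grng G (\<alpha> v) \<and>
      gsrc G (?z v) = grng G (\<beta> v) \<and> gmult G (?z v) (\<beta> v) = \<alpha> v"
    by eventually_elim (blast intro: mult_inv_closed rng_mult_inv src_mult_inv mult_inv_cancel)
  have arr: "a \<in> arrows G" "b \<in> arrows G" "h \<in> arrows G" and src: "gsrc G a = x" "gsrc G b = x"
    using a(1) b(1) limitin_topspace[OF h] by (auto simp: src_fibre_def arrows_def)
  \<comment> \<open>The arrow h may be one of several limits, but its range and source are limits of
    units and hence determined. This makes the product a^-1 h b defined.\<close>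
  have hr: "grng G h = grng G a"
  proof (rule limitin_units_unique[OF limitin_rng[OF h] _ \<Psi>(2)])
    show "limitin (gtop G) (\<lambda>v. grng G (?z v)) (grng G a) \<Psi>"
      by (rule limitin_transform_eventually[OF _ limitin_rng[OF \<alpha>lim]])
        (use z in eventually_elim, simp)
    show "\<forall>\<^sub>F v in \<Psi>. grng G (?z v) \<in> unit_space G"
      using z by eventually_elim (blast intro: rng_unit)
  qed (use arr in \<open>auto intro: rng_unit\<close>)
  have hs: "gsrc G h = grng G b"
  proof (rule limitin_units_unique[OF limitin_src[OF h] _ \<Psi>(2)])
    show "limitin (gtop G) (\<lambda>v. gsrc G (?z v)) (grng G b) \<Psi>"
      by (rule limitin_transform_eventually[OF _ limitin_rng[OF \<beta>lim]])
        (use z in eventually_elim, simp)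
    show "\<forall>\<^sub>F v in \<Psi>. gsrc G (?z v) \<in> unit_space G"
      using z by eventually_elim (blast intro: src_unit)
  qed (use arr in \<open>auto intro: rng_unit src_unit\<close>)
  have zb: "limitin (gtop G) (\<lambda>v. gmult G (?z v) (\<beta> v)) (gmult G h b) \<Psi>"
    by (rule limitin_mult[OF h \<beta>lim]) (use z in eventually_elim, simp_all add: hs)
  have hb: "(h, b) \<in> composable G" "gmult G h b \<in> arrows G" "grng G (gmult G h b) = grng G a"
    "gsrc G (gmult G h b) = x"
    using arr hr hs src by (auto simp: composable_iff mult_closed rng_mult src_mult)
  have "limitin (gtop G) (\<lambda>v. gmult G (ginv G (\<alpha> v)) (gmult G (?z v) (\<beta> v)))
      (gmult G (ginv G a) (gmult G h b)) \<Psi>"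
  proof (rule limitin_mult[OF limitin_inv[OF \<alpha>lim] zb])
    show "\<forall>\<^sub>F v in \<Psi>. gsrc G (ginv G (\<alpha> v)) = grng G (gmult G (?z v) (\<beta> v))"
      using ev z by eventually_elim (simp add: src_inv src_fibre_def)
  qed (use arr hb in \<open>simp add: src_inv\<close>)
  moreover have "\<forall>\<^sub>F v in \<Psi>. gmult G (ginv G (\<alpha> v)) (gmult G (?z v) (\<beta> v)) = v"
    using ev z by eventually_elim (simp add: inv_mult src_fibre_def)
  ultimately have "limitin (gtop G) (\<lambda>v. v) (gmult G (ginv G a) (gmult G h b)) \<Psi>"
    by (rule limitin_transform_eventually[rotated])
  moreover have "gmult G (ginv G a) (gmult G h b) \<in> isotropy G x"
    using arr hb src
    by (simp add: isotropy_def src_fibre_def rng_fibre_def composable_iff mult_closed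
        src_mult rng_mult inv_closed src_inv rng_inv)
  \<comment> \<open>The isotropy assumption is applied here. It is stated for all nontrivial filters
    below \<Phi> because \<Psi> arises by passing to a finer filter.\<close>
  ultimately have eq: "gmult G (ginv G a) (gmult G h b) = x"
    by (rule isotropy_limit[OF \<Psi>])
  \<comment> \<open>The equation a^-1 h b = x is solved for h by multiplying with a on the left and
    b^-1 on the right.\<close>
  have "gmult G h b = gmult G (gmult G a (ginv G a)) (gmult G h b)"
    using arr hb rng_mult_self[OF hb(2)] by (simp add: mult_inv)
  also have "\<dots> = gmult G a (gmult G (ginv G a) (gmult G h b))"
    using arr hb by (intro mult_assoc) (auto simp: composable_iff inv_closed rng_inv src_inv)
  also have "\<dots> = a"
    using eq mult_src[of a] arr src by simp
  finally have "gmult G a (ginv G b) = gmult G (gmult G h b) (ginv G b)" by simp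
  also have "\<dots> = gmult G h (gmult G b (ginv G b))"
    using arr hb by (intro mult_assoc) (auto simp: composable_iff inv_closed rng_inv)
  also have "\<dots> = h"
    using arr hs mult_src[of h] by (simp add: mult_inv)
  finally show ?thesis ..
qed

text \<open>Distinct arrows need not have disjoint neighbourhoods, so separation comes from the
  isotropy assumption. If \<alpha> and \<beta> agreed frequently, the units r(\<alpha> v) = \<alpha>
  v (\<beta> v)^-1 would converge to r(a), forcing r(a) = a b^-1 and hence a = b.\<close>

lemma sections_eventually_distinct:
  assumes a: "a \<in> src_fibre G x" "limitin (gtop G) \<alpha> a \<Phi>" "\<forall>\<^sub>F v in \<Phi>. \<alpha> v \<in> src_fibre G v"
    and b: "b \<in> src_fibre G x" "limitin (gtop G) \<beta> b \<Phi>" "\<forall>\<^sub>F v in \<Phi>. \<beta> v \<in> src_fibre G v"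
    and "a \<noteq> b"
  shows "\<forall>\<^sub>F v in \<Phi>. \<alpha> v \<noteq> \<beta> v"
proof (rule ccontr)
  \<comment> \<open>The restriction to the coincidence set is a nontrivial filter exactly when the
    sections are not eventually distinct.\<close>
  let ?\<Psi> = "inf \<Phi> (principal {v. \<alpha> v = \<beta> v})"
  assume "\<not> ?thesis"
  then have \<Psi>: "?\<Psi> \<le> \<Phi>" "?\<Psi> \<noteq> bot"
    by (auto simp: trivial_limit_def eventually_inf_principal)
  have arr: "a \<in> arrows G" "b \<in> arrows G"
    using a b by (auto simp: src_fibre_def)
  note \<alpha>lim = limitin_subfilter[OF a(2) \<Psi>(1)]
  have "\<forall>\<^sub>F v in ?\<Psi>. \<alpha> v \<in> src_fibre G v \<and> \<alpha> v = \<beta> v"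
    using filter_leD[OF \<Psi>(1) a(3)] by (auto simp: eventually_inf_principal elim: eventually_mono)
  then have "\<forall>\<^sub>F v in ?\<Psi>. grng G (\<alpha> v) = gmult G (\<alpha> v) (ginv G (\<beta> v))"
    by eventually_elim (auto simp: mult_inv src_fibre_def)
  then have "grng G a = gmult G a (ginv G b)"
    by (intro section_quotient_limit[OF a b \<Psi>] limitin_transform_eventually[OF _ limitin_rng[OF \<alpha>lim]])
  then have "gmult G (grng G a) b = a"
    using mult_inv_cancel[OF a(1) b(1)] by simp
  moreover have "grng G a = grng G b"
    using \<open>grng G a = gmult G a (ginv G b)\<close> src_mult_inv[OF a(1) b(1)]
      unit_spaceD(2)[OF rng_unit[OF arr(1)]] by simp
  ultimately show False
    using rng_mult_self[OF arr(2)] \<open>a \<noteq> b\<close> by simp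
qed

text \<open>The zero extension of f can jump at boundary points of V, so convergence of the arrows
  suffices only when the limit lies in V. Otherwise the quotients must be shown to leave the compact
  support.\<close>

lemma Cc_on_section_quotient_tendsto:
  assumes V: "openin (gtop G) V" "f \<in> Cc_on (gtop G) V"
    and a: "a \<in> src_fibre G x" "limitin (gtop G) \<alpha> a \<Phi>" "\<forall>\<^sub>F v in \<Phi>. \<alpha> v \<in> src_fibre G v"
    and b: "b \<in> src_fibre G x" "limitin (gtop G) \<beta> b \<Phi>" "\<forall>\<^sub>F v in \<Phi>. \<beta> v \<in> src_fibre G v"
  shows "((\<lambda>v. f (gmult G (\<alpha> v) (ginv G (\<beta> v)))) \<longlongrightarrow> f (gmult G a (ginv G b))) \<Phi>"
proof (cases "gmult G a (ginv G b) \<in> V")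
  case True
  let ?z = "\<lambda>v. gmult G (\<alpha> v) (ginv G (\<beta> v))"
  have ev: "\<forall>\<^sub>F v in \<Phi>. gsrc G (\<alpha> v) = grng G (ginv G (\<beta> v))"
    using a(3) b(3) by eventually_elim (auto simp: src_fibre_def rng_inv)
  have "limitin (gtop G) ?z (gmult G a (ginv G b)) \<Phi>"
    using a(1) b(1) by (intro limitin_mult limitin_inv a(2) b(2) ev) (auto simp: src_fibre_def rng_inv)
  then have "limitin (subtopology (gtop G) V) ?z (gmult G a (ginv G b)) \<Phi>"
    using True V(1) limitinD[of _ ?z] by (auto simp: limitin_subtopology)
  moreover have "continuous_map (subtopology (gtop G) V) euclidean f"
    using V(2) by (simp add: Cc_on_def)
  ultimately have "limitin euclidean (f \<circ> ?z) (f (gmult G a (ginv G b))) \<Phi>"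
    by (rule continuous_map_limit[rotated])
  then show ?thesis
    by (simp add: o_def)
next
  case False
  let ?z = "\<lambda>v. gmult G (\<alpha> v) (ginv G (\<beta> v))"
  obtain K where K: "compactin (gtop G) K" "K \<subseteq> V" "\<And>h. h \<notin> K \<Longrightarrow> f h = 0"
    using Cc_on_compact_support[OF V] by blast
  have "\<forall>\<^sub>F v in \<Phi>. ?z v \<notin> K"
  proof (rule ccontr)
    let ?\<Psi> = "inf \<Phi> (principal {v. ?z v \<in> K})"
    assume "\<not> ?thesis"
    then have \<Psi>: "?\<Psi> \<le> \<Phi>" "?\<Psi> \<noteq> bot" "\<forall>\<^sub>F v in ?\<Psi>. ?z v \<in> K"
      by (auto simp: trivial_limit_def eventually_inf_principal)
    obtain h \<Psi>' where h: "h \<in> K" "\<Psi>' \<le> ?\<Psi>" "\<Psi>' \<noteq> bot" "limitin (gtop G) ?z h \<Psi>'"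
      using compactin_subfilter_limit[OF K(1) \<Psi>(2,3)] by blast
    have "h = gmult G a (ginv G b)"
      by (rule section_quotient_limit[OF a b order_trans[OF h(2) \<Psi>(1)] h(3,4)])
    then show False using h(1) K(2) False by blast
  qed
  then have "\<forall>\<^sub>F v in \<Phi>. f (?z v) = f (gmult G a (ginv G b))"
    by eventually_elim (use K False in auto)
  then show ?thesis by (rule tendsto_eventually)
qed

lemma Cc_section_quotient_tendsto:
  assumes f: "f \<in> Cc G"
    and a: "a \<in> src_fibre G x" "limitin (gtop G) \<alpha> a \<Phi>" "\<forall>\<^sub>F v in \<Phi>. \<alpha> v \<in> src_fibre G v"
    and b: "b \<in> src_fibre G x" "limitin (gtop G) \<beta> b \<Phi>" "\<forall>\<^sub>F v in \<Phi>. \<beta> v \<in> src_fibre G v"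
  shows "((\<lambda>v. f (gmult G (\<alpha> v) (ginv G (\<beta> v)))) \<longlongrightarrow> f (gmult G a (ginv G b))) \<Phi>"
proof -
  obtain n :: nat and c u where
    u: "\<forall>k<n. \<exists>V. openin (gtop G) V \<and> Hausdorff_space (subtopology (gtop G) V) \<and>
        u k \<in> Cc_on (gtop G) V"
    and f: "f = (\<lambda>g. \<Sum>k<n. c k * u k g)"
    using f by (auto simp: Cc_def)
  show ?thesis
    unfolding f
  proof (intro tendsto_sum tendsto_mult_left)
    fix k assume "k \<in> {..<n}"
    then obtain V where "openin (gtop G) V" "u k \<in> Cc_on (gtop G) V"
      using u by auto
    then show "((\<lambda>v. u k (gmult G (\<alpha> v) (ginv G (\<beta> v)))) \<longlongrightarrow> u k (gmult G a (ginv G b))) \<Phi>"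
      by (rule Cc_on_section_quotient_tendsto[OF _ _ a b])
  qed
qed

text \<open>
  A finitely supported vector on the fibre over \<open>x\<close> is transported along local sections to the
  nearby fibres. The sections are eventually disjoint, so this preserves its norm.
\<close>

lemma rho_limit_bound:
  assumes f: "f \<in> Cc G" and x: "x \<in> unit_space G" and \<Phi>: "\<Phi> \<noteq> bot" and C: "0 \<le> C"
    and bound: "\<forall>\<^sub>F v in \<Phi>. \<forall>\<xi>\<in>ell2 (src_fibre G v). rho G v f \<xi> \<in> ell2 (src_fibre G v) \<and>
      ell2_norm (src_fibre G v) (rho G v f \<xi>) \<le> C * ell2_norm (src_fibre G v) \<xi>"
    and \<xi>: "\<xi> \<in> ell2 (src_fibre G x)"
  shows "ell2_norm (src_fibre G x) (rho G x f \<xi>) \<le> C * ell2_norm (src_fibre G x) \<xi>"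
proof (rule ell2_bounded(2))
  show "rho G x f \<xi> s = 0" if "s \<notin> src_fibre G x" for s
    using that by (rule rho_outside)
  fix A assume A: "finite A" "A \<subseteq> src_fibre G x"
  have fin: "finite_on_fibres f"
    using uniformly_bounded_Cc[OF f] by (simp add: uniformly_bounded_def)
  \<comment> \<open>P collects the columns that meet the rows in A. It is finite because rows are
    finite, so the corner with rows A and columns P computes \<open>rho G x f \<xi>\<close> on A
    without error.\<close>
  define P where "P = (\<Union>a\<in>A. {p \<in> src_fibre G x. f (gmult G a (ginv G p)) \<noteq> 0})"
  have P: "finite P" "P \<subseteq> src_fibre G x"
    using A finite_kernel_row[OF fin] by (auto simp: P_def)
  have "\<forall>q\<in>src_fibre G x. \<exists>\<alpha>. limitin (gtop G) \<alpha> q \<Phi> \<and> (\<forall>\<^sub>F v in \<Phi>. \<alpha> v \<in> src_fibre G v)"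
    using local_section[OF _ lim units] by blast
  then obtain \<alpha> where \<alpha>: "\<And>q. q \<in> src_fibre G x \<Longrightarrow> limitin (gtop G) (\<alpha> q) q \<Phi>"
    "\<And>q. q \<in> src_fibre G x \<Longrightarrow> \<forall>\<^sub>F v in \<Phi>. \<alpha> q v \<in> src_fibre G v"
    by metis
  let ?Q = "A \<union> P"
  have Q: "finite ?Q" "?Q \<subseteq> src_fibre G x"
    using A P by auto
  have "\<forall>\<^sub>F v in \<Phi>. \<forall>q\<in>?Q. \<alpha> q v \<in> src_fibre G v"
    using Q \<alpha>(2) by (intro eventually_ball_finite) auto
  moreover have "\<forall>\<^sub>F v in \<Phi>. \<forall>q\<in>?Q. \<forall>q'\<in>?Q. q \<noteq> q' \<longrightarrow> \<alpha> q v \<noteq> \<alpha> q' v"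
  proof (intro eventually_ball_finite Q(1) ballI)
    fix q q' assume "q \<in> ?Q" "q' \<in> ?Q"
    then have "q \<in> src_fibre G x" "q' \<in> src_fibre G x"
      using Q by blast+
    then show "\<forall>\<^sub>F v in \<Phi>. q \<noteq> q' \<longrightarrow> \<alpha> q v \<noteq> \<alpha> q' v"
      using sections_eventually_distinct[OF _ \<alpha>(1,2) _ \<alpha>(1,2), of q q'] by (cases "q = q'") simp_all
  qed
  ultimately have le: "\<forall>\<^sub>F v in \<Phi>. L2_set (\<lambda>a. cmod (\<Sum>p\<in>P. f (gmult G (\<alpha> a v) (ginv G (\<alpha> p v))) * \<xi> p)) A
      \<le> C * ell2_norm (src_fibre G x) \<xi>"
    using bound
  proof eventually_elim
    case (elim v)
    let ?s = "\<lambda>q. \<alpha> q v"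
    have s: "?s q \<in> src_fibre G v" if "q \<in> ?Q" for q
      using elim that by blast
    have inj: "inj_on ?s ?Q"
      using elim(2) unfolding inj_on_def by blast
    then have injP: "inj_on ?s P" and injA: "inj_on ?s A"
      by (auto intro: inj_on_subset)
    \<comment> \<open>This is \<xi> cut down to P and carried to the fibre over v. Injectivity of
      the sections on P makes its values well defined and bounds its norm by that of \<xi>.\<close>
    define \<zeta> where "\<zeta> t = (if t \<in> ?s ` P then \<xi> (inv_into P ?s t) else 0)" for t
    have \<zeta>: "\<zeta> (?s p) = \<xi> p" if "p \<in> P" for p
      using that inv_into_f_f[OF injP that] by (simp add: \<zeta>_def)
    have \<zeta>0: "\<zeta> t = 0" if "t \<notin> src_fibre G v" for t
      using that s by (auto simp: \<zeta>_def)
    have \<zeta>bd: "L2_set (\<lambda>t. cmod (\<zeta> t)) F \<le> ell2_norm (src_fibre G x) \<xi>" if F: "finite F" for F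
    proof -
      have "L2_set (\<lambda>t. cmod (\<zeta> t)) F \<le> L2_set (\<lambda>t. cmod (\<zeta> t)) (?s ` P)"
        unfolding L2_set_def
      proof (rule real_sqrt_le_mono)
        have "(\<Sum>t\<in>F. (cmod (\<zeta> t))\<^sup>2) = (\<Sum>t\<in>F \<inter> ?s ` P. (cmod (\<zeta> t))\<^sup>2)"
          using F by (intro sum.mono_neutral_right) (auto simp: \<zeta>_def)
        also have "\<dots> \<le> (\<Sum>t\<in>?s ` P. (cmod (\<zeta> t))\<^sup>2)"
          using P(1) by (intro sum_mono2) auto
        finally show "(\<Sum>t\<in>F. (cmod (\<zeta> t))\<^sup>2) \<le> (\<Sum>t\<in>?s ` P. (cmod (\<zeta> t))\<^sup>2)" .
      qed
      also have "\<dots> = L2_set (\<lambda>p. cmod (\<xi> p)) P"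
        unfolding L2_set_def by (simp add: sum.reindex[OF injP] \<zeta>)
      also have "\<dots> \<le> ell2_norm (src_fibre G x) \<xi>"
        by (rule L2_set_le_ell2_norm[OF \<xi> P])
      finally show ?thesis .
    qed
    have \<zeta>_ell2: "\<zeta> \<in> ell2 (src_fibre G v)" and \<zeta>_norm: "ell2_norm (src_fibre G v) \<zeta> \<le> ell2_norm (src_fibre G x) \<xi>"
      using ell2_bounded[of "src_fibre G v" \<zeta> "ell2_norm (src_fibre G x) \<xi>"] \<zeta>0 \<zeta>bd by blast+
    have val: "rho G v f \<zeta> (?s a) = (\<Sum>p\<in>P. f (gmult G (?s a) (ginv G (?s p))) * \<xi> p)" if "a \<in> A" for a
    proof -
      have "rho G v f \<zeta> (?s a) = (\<Sum>\<^sub>\<infinity>t\<in>src_fibre G v. f (gmult G (?s a) (ginv G t)) * \<zeta> t)"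
        using that s by (intro rho_eq \<zeta>_ell2) auto
      also have "\<dots> = (\<Sum>\<^sub>\<infinity>t\<in>?s ` P. f (gmult G (?s a) (ginv G t)) * \<zeta> t)"
        using s by (intro infsum_cong_neutral) (auto simp: \<zeta>_def)
      also have "\<dots> = (\<Sum>t\<in>?s ` P. f (gmult G (?s a) (ginv G t)) * \<zeta> t)"
        using P(1) by simp
      also have "\<dots> = (\<Sum>p\<in>P. f (gmult G (?s a) (ginv G (?s p))) * \<xi> p)"
        by (simp add: sum.reindex[OF injP] \<zeta>)
      finally show ?thesis .
    qed
    have "L2_set (\<lambda>a. cmod (\<Sum>p\<in>P. f (gmult G (?s a) (ginv G (?s p))) * \<xi> p)) A
        = L2_set (\<lambda>t. cmod (rho G v f \<zeta> t)) (?s ` A)"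
      unfolding L2_set_def by (simp add: sum.reindex[OF injA] val)
    also have "\<dots> \<le> ell2_norm (src_fibre G v) (rho G v f \<zeta>)"
      using A(1) s bspec[OF elim(3) \<zeta>_ell2] by (intro L2_set_le_ell2_norm) blast+
    also have "\<dots> \<le> C * ell2_norm (src_fibre G v) \<zeta>"
      using bspec[OF elim(3) \<zeta>_ell2] by blast
    also have "\<dots> \<le> C * ell2_norm (src_fibre G x) \<xi>"
      by (rule mult_left_mono[OF \<zeta>_norm C])
    finally show ?case .
  qed
  have "L2_set (\<lambda>a. cmod (rho G x f \<xi> a)) A
      = L2_set (\<lambda>a. cmod (\<Sum>p\<in>P. f (gmult G a (ginv G p)) * \<xi> p)) A"
  proof (rule L2_set_cong[OF refl])
    fix a assume a: "a \<in> A"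
    then have "rho G x f \<xi> a = (\<Sum>\<^sub>\<infinity>p\<in>src_fibre G x. f (gmult G a (ginv G p)) * \<xi> p)"
      using A by (intro rho_eq \<xi>) auto
    also have "\<dots> = (\<Sum>\<^sub>\<infinity>p\<in>P. f (gmult G a (ginv G p)) * \<xi> p)"
      using a P(2) by (intro infsum_cong_neutral) (auto simp: P_def)
    finally show "cmod (rho G x f \<xi> a) = cmod (\<Sum>p\<in>P. f (gmult G a (ginv G p)) * \<xi> p)"
      using P(1) by simp
  qed
  also have "\<dots> \<le> C * ell2_norm (src_fibre G x) \<xi>"
  \<comment> \<open>For fixed finite A and P the corner norm depends continuously on finitely many
    matrix entries, each of which converges along \<Phi>.\<close>
  proof (rule tendsto_upperbound[OF _ le \<Phi>])
    have lim_f: "((\<lambda>v. f (gmult G (\<alpha> a v) (ginv G (\<alpha> p v)))) \<longlongrightarrow> f (gmult G a (ginv G p))) \<Phi>"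
      if "a \<in> A" "p \<in> P" for a p
    proof -
      have "a \<in> src_fibre G x" "p \<in> src_fibre G x"
        using that A P by auto
      then show ?thesis
        by (intro Cc_section_quotient_tendsto[OF f] \<alpha>)
    qed
    show "((\<lambda>v. L2_set (\<lambda>a. cmod (\<Sum>p\<in>P. f (gmult G (\<alpha> a v) (ginv G (\<alpha> p v))) * \<xi> p)) A)
        \<longlongrightarrow> L2_set (\<lambda>a. cmod (\<Sum>p\<in>P. f (gmult G a (ginv G p)) * \<xi> p)) A) \<Phi>"
      unfolding L2_set_def
      by (intro tendsto_real_sqrt tendsto_sum tendsto_power tendsto_norm tendsto_mult_right lim_f)
  qed
  finally show "L2_set (\<lambda>a. cmod (rho G x f \<xi> a)) A \<le> C * ell2_norm (src_fibre G x) \<xi>" .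
qed

end

end

section \<open>Extension to the reduced algebra\<close>

context etale_groupoid
begin

lemma cauchy_seqs_uniformly_bounded: "\<sigma> \<in> cauchy_seqs G \<Longrightarrow> uniformly_bounded (\<sigma> n)"
  by (intro uniformly_bounded_Cc) (auto simp: cauchy_seqs_def)

lemma op_norm_rho_diff_le:
  assumes "uniformly_bounded f" "uniformly_bounded f'" "u \<in> unit_space G"
  shows "op_norm (src_fibre G u) (rho G u f - rho G u f') \<le> red_norm G (f - f')"
  using op_norm_rho_le_red_norm[OF uniformly_bounded_diff[OF assms(1,2)] assms(3)]
  by (simp add: rho_diff[OF assms(1,2)])

text \<open>A nonempty unit space ensures that the supremum of the constant 0 in
  \<open>red_norm\<close> equals 0.\<close>

lemma null_equiv_refl:
  assumes "\<sigma> \<in> cauchy_seqs G" "unit_space G \<noteq> {}"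
  shows "(\<sigma>, \<sigma>) \<in> null_equiv G"
proof -
  note ub = cauchy_seqs_uniformly_bounded[OF assms(1)]
  have "op_norm (src_fibre G u) (rho G u (\<sigma> n - \<sigma> n)) = 0" for u n
    using rho_diff[OF ub[of n] ub[of n], of u] op_norm_le[of "src_fibre G u" 0 0] op_norm_nonneg[OF zero_bounded_ops, of "src_fibre G u"]
    by simp
  then have "red_norm G (\<sigma> n - \<sigma> n) = 0" for n
    using assms(2) by (simp add: red_norm_def)
  then show ?thesis
    using assms(1) by (simp add: null_equiv_def)
qed

text \<open>This justifies the definite description in \<open>rho_ext\<close>. Completeness yields a
  limit for one representative, domination by \<open>red_norm\<close> transfers it to all others,
  and the operator norm separates limits.\<close>

lemma rho_ext_ex1:
  assumes b: "b \<in> elems (reduced_algebra G)" and u: "u \<in> unit_space G"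
  shows "\<exists>!T. T \<in> bounded_ops (src_fibre G u) \<and>
     (\<forall>\<sigma>\<in>b. (\<lambda>n. op_norm (src_fibre G u) (rho G u (\<sigma> n) - T)) \<longlonglongrightarrow> 0)"
proof -
  let ?S = "src_fibre G u"
  obtain \<sigma> where \<sigma>: "\<sigma> \<in> cauchy_seqs G" and b_eq: "b = null_equiv G `` {\<sigma>}"
    using b by (auto simp: reduced_algebra_def elim: quotientE)
  have ops: "rho G u (\<tau> n) \<in> bounded_ops ?S" if "\<tau> \<in> cauchy_seqs G" for \<tau> n
    by (rule rho_bounded_ops[OF cauchy_seqs_uniformly_bounded[OF that] u])
  have \<sigma>b: "\<sigma> \<in> b"
    using null_equiv_refl[OF \<sigma>] u by (auto simp: b_eq)
  have "\<exists>T\<in>bounded_ops ?S. (\<lambda>n. op_norm ?S (rho G u (\<sigma> n) - T)) \<longlonglongrightarrow> 0"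
  proof (rule bounded_ops_complete[OF ops[OF \<sigma>]])
    fix e :: real assume "e > 0"
    then obtain N where "\<forall>m\<ge>N. \<forall>n\<ge>N. red_norm G (\<sigma> m - \<sigma> n) < e"
      using \<sigma> by (auto simp: cauchy_seqs_def)
    then show "\<exists>N. \<forall>m\<ge>N. \<forall>n\<ge>N. op_norm ?S (rho G u (\<sigma> m) - rho G u (\<sigma> n)) < e"
      using op_norm_rho_diff_le[OF cauchy_seqs_uniformly_bounded[OF \<sigma>] cauchy_seqs_uniformly_bounded[OF \<sigma>] u]
      by (blast intro: le_less_trans)
  qed
  then obtain T where T: "T \<in> bounded_ops ?S" and lim: "(\<lambda>n. op_norm ?S (rho G u (\<sigma> n) - T)) \<longlonglongrightarrow> 0"
    by blast
  show ?thesis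
  proof (rule ex1I[of _ T], intro conjI ballI)
    show "T \<in> bounded_ops ?S" by (rule T)
    fix \<tau> assume "\<tau> \<in> b"
    then have \<tau>: "\<tau> \<in> cauchy_seqs G" and null: "(\<lambda>n. red_norm G (\<sigma> n - \<tau> n)) \<longlonglongrightarrow> 0"
      by (auto simp: b_eq null_equiv_def)
    show "(\<lambda>n. op_norm ?S (rho G u (\<tau> n) - T)) \<longlonglongrightarrow> 0"
    proof (rule tendsto_sandwich[OF _ _ tendsto_const])
      show "(\<lambda>n. red_norm G (\<sigma> n - \<tau> n) + op_norm ?S (rho G u (\<sigma> n) - T)) \<longlonglongrightarrow> 0"
        using tendsto_add[OF null lim] by simp
      show "\<forall>\<^sub>F n in sequentially. 0 \<le> op_norm ?S (rho G u (\<tau> n) - T)"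
        by (intro always_eventually allI op_norm_nonneg bounded_ops_diff ops \<tau> T)
      have "op_norm ?S (rho G u (\<tau> n) - T)
          \<le> red_norm G (\<sigma> n - \<tau> n) + op_norm ?S (rho G u (\<sigma> n) - T)" for n
        using op_norm_triangle_diff[OF ops[OF \<tau>] ops[OF \<sigma>] T, of n n]
          op_norm_minus_commute[of ?S "rho G u (\<tau> n)" "rho G u (\<sigma> n)"]
          op_norm_rho_diff_le[OF cauchy_seqs_uniformly_bounded[OF \<sigma>] cauchy_seqs_uniformly_bounded[OF \<tau>] u, of n n]
        by linarith
      then show "\<forall>\<^sub>F n in sequentially. op_norm ?S (rho G u (\<tau> n) - T)
          \<le> red_norm G (\<sigma> n - \<tau> n) + op_norm ?S (rho G u (\<sigma> n) - T)"
        by simp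
    qed
  next
    fix T' assume "T' \<in> bounded_ops ?S \<and> (\<forall>\<sigma>\<in>b. (\<lambda>n. op_norm ?S (rho G u (\<sigma> n) - T')) \<longlonglongrightarrow> 0)"
    then have T': "T' \<in> bounded_ops ?S" and lim': "(\<lambda>n. op_norm ?S (rho G u (\<sigma> n) - T')) \<longlonglongrightarrow> 0"
      using \<sigma>b by auto
    have "op_norm ?S (T' - T) \<le> 0"
    proof (rule tendsto_lowerbound)
      show "(\<lambda>n. op_norm ?S (rho G u (\<sigma> n) - T') + op_norm ?S (rho G u (\<sigma> n) - T)) \<longlonglongrightarrow> 0"
        using tendsto_add[OF lim' lim] by simp
      have "op_norm ?S (T' - T) \<le> op_norm ?S (rho G u (\<sigma> n) - T') + op_norm ?S (rho G u (\<sigma> n) - T)" for n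
        using op_norm_triangle_diff[OF T' ops[OF \<sigma>] T, of n]
          op_norm_minus_commute[of ?S T' "rho G u (\<sigma> n)"] by linarith
      then show "\<forall>\<^sub>F n in sequentially. op_norm ?S (T' - T)
          \<le> op_norm ?S (rho G u (\<sigma> n) - T') + op_norm ?S (rho G u (\<sigma> n) - T)"
        by simp
    qed simp
    then have "T' - T = 0"
      by (rule op_norm_le_0D[OF bounded_ops_diff[OF T' T]])
    then show "T' = T" by simp
  qed
qed

lemma
  assumes "b \<in> elems (reduced_algebra G)" "u \<in> unit_space G"
  shows rho_ext_bounded_ops: "rho_ext G u b \<in> bounded_ops (src_fibre G u)"
    and rho_ext_limit: "\<sigma> \<in> b \<Longrightarrow>
      (\<lambda>n. op_norm (src_fibre G u) (rho G u (\<sigma> n) - rho_ext G u b)) \<longlonglongrightarrow> 0"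
  using theI'[OF rho_ext_ex1[OF assms], folded rho_ext_def] by simp_all

lemma rho_ext_eq_0I:
  assumes "b \<in> elems (reduced_algebra G)" "u \<in> unit_space G"
    and "\<And>\<sigma>. \<sigma> \<in> b \<Longrightarrow> (\<lambda>n. op_norm (src_fibre G u) (rho G u (\<sigma> n))) \<longlonglongrightarrow> 0"
  shows "rho_ext G u b = 0"
  unfolding rho_ext_def
  using assms(3) by (intro the1_equality[OF rho_ext_ex1[OF assms(1,2)]]) (simp add: zero_bounded_ops)

text \<open>Uniformity over \<open>Y\<close> comes from the Cauchy condition in the reduced norm.\<close>

lemma op_norm_uniformly_small:
  assumes b: "b \<in> elems (reduced_algebra G)" and \<sigma>: "\<sigma> \<in> b" "\<sigma> \<in> cauchy_seqs G"
    and Y: "Y \<subseteq> unit_space G" "\<And>v. v \<in> Y \<Longrightarrow> rho_ext G v b = 0" and "e > 0"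
  shows "\<exists>N. \<forall>n\<ge>N. \<forall>v\<in>Y. op_norm (src_fibre G v) (rho G v (\<sigma> n)) \<le> e"
proof -
  obtain N where N: "\<forall>m\<ge>N. \<forall>n\<ge>N. red_norm G (\<sigma> m - \<sigma> n) < e"
    using \<sigma>(2) \<open>e > 0\<close> by (auto simp: cauchy_seqs_def)
  \<comment> \<open>N was fixed before v. With n fixed, letting m tend to infinity removes the term
    at m, because its limit operator \<open>rho_ext G v b\<close> is zero.\<close>
  have "op_norm (src_fibre G v) (rho G v (\<sigma> n)) \<le> e" if n: "n \<ge> N" and v: "v \<in> Y" for n v
  proof (rule tendsto_lowerbound)
    let ?S = "src_fibre G v"
    have u: "v \<in> unit_space G" using v Y(1) by blast
    note ub = cauchy_seqs_uniformly_bounded[OF \<sigma>(2)]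
    have lim: "(\<lambda>m. op_norm ?S (rho G v (\<sigma> m) - 0)) \<longlonglongrightarrow> 0"
      using rho_ext_limit[OF b u \<sigma>(1)] Y(2)[OF v] by simp
    show "(\<lambda>m. e + op_norm ?S (rho G v (\<sigma> m) - 0)) \<longlonglongrightarrow> e"
      using tendsto_add[OF tendsto_const lim] by simp
    have "op_norm ?S (rho G v (\<sigma> n)) \<le> e + op_norm ?S (rho G v (\<sigma> m) - 0)" if "m \<ge> N" for m
    proof -
      have "op_norm ?S (rho G v (\<sigma> n) - 0)
          \<le> op_norm ?S (rho G v (\<sigma> n) - rho G v (\<sigma> m)) + op_norm ?S (rho G v (\<sigma> m) - 0)"
        by (intro op_norm_triangle_diff rho_bounded_ops ub u zero_bounded_ops)
      moreover have "op_norm ?S (rho G v (\<sigma> n) - rho G v (\<sigma> m)) \<le> red_norm G (\<sigma> n - \<sigma> m)"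
        by (rule op_norm_rho_diff_le[OF ub ub u])
      moreover have "red_norm G (\<sigma> n - \<sigma> m) < e"
        using N n that by blast
      ultimately show ?thesis by simp
    qed
    then show "\<forall>\<^sub>F m in sequentially. op_norm ?S (rho G v (\<sigma> n)) \<le> e + op_norm ?S (rho G v (\<sigma> m) - 0)"
      by (auto simp: eventually_sequentially)
  qed simp
  then show ?thesis by blast
qed

end

section \<open>Kernels of direct sums, and the filter of the net\<close>

lemma rep_kernel_rep_sumD:
  assumes b: "b \<in> rep_kernel A (ell2_sum Y S) (rep_sum Y \<pi>)"
    and v: "v \<in> Y" "\<pi> v b \<in> bounded_ops (S v)"
  shows "\<pi> v b = 0"
proof
  fix \<xi>
  show "\<pi> v b \<xi> = 0 \<xi>"
  proof (cases "\<xi> \<in> ell2 (S v)")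
    case True
    \<comment> \<open>A vector concentrated in the summand at v detects the component of the direct
      sum there.\<close>
    let ?\<eta> = "\<lambda>w. if w = v then \<xi> else 0"
    have "(\<lambda>w. (ell2_norm (S w) (?\<eta> w))\<^sup>2) summable_on Y"
      by (rule finite_nonzero_values_imp_summable_on, rule finite_subset[of _ "{v}"]) auto
    then have "?\<eta> \<in> ell2_sum Y S"
      using True v by (auto simp: ell2_sum_def)
    then have "rep_sum Y \<pi> b ?\<eta> v = 0"
      using b by (auto simp: rep_kernel_def)
    then show ?thesis
      using v by (simp add: rep_sum_def)
  next
    case False
    then show ?thesis using v by (simp add: bounded_ops_def)
  qed
qed

text \<open>The net only accumulates at x, so a subnet converging to x is needed. Its role is played
  by a filter on the values of the net, which lets local sections be functions of the unit v
  itself.\<close>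

lemma (in etale_groupoid) accumulating_net_filter:
  assumes I: "directed_set I le" and yY: "\<forall>i\<in>I. y i \<in> Y"
    and x: "accumulation_point (gtop G) I le y x"
  obtains \<Phi> where "\<Phi> \<noteq> bot" "limitin (gtop G) (\<lambda>v. v) x \<Phi>" "\<forall>\<^sub>F v in \<Phi>. v \<in> Y"
    "\<And>\<Psi> g. \<Psi> \<le> \<Phi> \<Longrightarrow> \<Psi> \<noteq> bot \<Longrightarrow> limitin (gtop G) (\<lambda>v. v) g \<Psi> \<Longrightarrow>
      accumulation_point (gtop G) I le y g"
proof -
  have I_ne: "I \<noteq> {}"
    and I_trans: "\<forall>i\<in>I. \<forall>j\<in>I. \<forall>k\<in>I. le i j \<longrightarrow> le j k \<longrightarrow> le i k"
    and I_dir: "\<forall>i\<in>I. \<forall>j\<in>I. \<exists>k\<in>I. le i k \<and> le j k"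
    using I unfolding directed_set_def by - (elim conjE, assumption)+
  \<comment> \<open>The filter of tails on the index set; directedness makes the tails a filter
    base.\<close>
  let ?T = "INF i\<in>I. principal {j \<in> I. le i j}"
  have ev_T: "eventually P ?T \<longleftrightarrow> (\<exists>i\<in>I. \<forall>j\<in>I. le i j \<longrightarrow> P j)" for P
  proof (subst eventually_INF_base)
    fix i j assume ij: "i \<in> I" "j \<in> I"
    then obtain k where k: "k \<in> I" "le i k" "le j k"
      using I_dir by blast
    have "le i' l" if "i' \<in> I" "l \<in> I" "le i' k" "le k l" for i' l
      using I_trans[rule_format, OF that(1) k(1) that(2)] that(3,4) by blast
    then have "{l \<in> I. le k l} \<subseteq> {l \<in> I. le i l} \<inter> {l \<in> I. le j l}"
      using k ij by auto
    then show "\<exists>k\<in>I. principal {l \<in> I. le k l} \<le> inf (principal {l \<in> I. le i l}) (principal {l \<in> I. le j l})"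
      using k by auto
  qed (auto simp: I_ne eventually_principal)
  \<comment> \<open>The infimum with the neighbourhoods of x forces convergence to x. It is
    nontrivial because every tail of the net meets every neighbourhood of x.\<close>
  define \<Phi> where "\<Phi> = inf (filtermap y ?T) (nhdsin (gtop G) x)"
  have xt: "x \<in> topspace (gtop G)"
    using x by (simp add: accumulation_point_def)
  have tail: "\<forall>\<^sub>F v in \<Phi>. P v" if "i \<in> I" "\<And>j. j \<in> I \<Longrightarrow> le i j \<Longrightarrow> P (y j)" for P i
  proof -
    have "eventually P (filtermap y ?T)"
      unfolding eventually_filtermap ev_T using that by (intro bexI[of _ i]) simp_all
    then show ?thesis
      by (rule filter_leD[rotated]) (simp add: \<Phi>_def)
  qed
  show ?thesis
  proof (rule that)
    show "\<Phi> \<noteq> bot"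
    proof
      assume "\<Phi> = bot"
      then have "eventually (\<lambda>_. False) \<Phi>" by simp
      then obtain Q R where Q: "eventually Q (filtermap y ?T)" and R: "eventually R (nhdsin (gtop G) x)"
        and QR: "\<And>v. Q v \<Longrightarrow> R v \<Longrightarrow> False"
        by (auto simp: \<Phi>_def eventually_inf)
      obtain i where i: "i \<in> I" "\<forall>j\<in>I. le i j \<longrightarrow> Q (y j)"
        using Q by (auto simp: eventually_filtermap ev_T)
      obtain U where U: "openin (gtop G) U" "x \<in> U" "\<forall>v\<in>U. R v"
        using R xt by (auto simp: eventually_nhdsin)
      obtain j where "j \<in> I" "le i j" "y j \<in> U"
        using x U(1,2) i(1) unfolding accumulation_point_def by blast
      then show False using i(2) U(3) QR by blast
    qed
    show "limitin (gtop G) (\<lambda>v. v) x \<Phi>"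
      unfolding limitin_def
    proof (intro conjI allI impI xt)
      fix U assume "openin (gtop G) U \<and> x \<in> U"
      then have "\<forall>\<^sub>F v in nhdsin (gtop G) x. v \<in> U"
        using xt by (auto simp: eventually_nhdsin)
      then show "\<forall>\<^sub>F v in \<Phi>. v \<in> U"
        by (rule filter_leD[rotated]) (simp add: \<Phi>_def)
    qed
    obtain i where "i \<in> I"
      using I_ne by blast
    then show "\<forall>\<^sub>F v in \<Phi>. v \<in> Y"
      by (rule tail) (simp add: yY)
    fix \<Psi> g assume \<Psi>: "\<Psi> \<le> \<Phi>" "\<Psi> \<noteq> bot" and g: "limitin (gtop G) (\<lambda>v. v) g \<Psi>"
    show "accumulation_point (gtop G) I le y g"
      unfolding accumulation_point_def
    proof (intro conjI allI impI ballI)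
      show "g \<in> topspace (gtop G)" by (rule limitin_topspace[OF g])
      fix U i assume U: "openin (gtop G) U \<and> g \<in> U" and i: "i \<in> I"
      have "\<forall>\<^sub>F v in \<Psi>. v \<in> y ` {j \<in> I. le i j}"
        by (rule filter_leD[OF \<Psi>(1)], rule tail[OF i]) simp
      moreover have "\<forall>\<^sub>F v in \<Psi>. v \<in> U"
        using limitinD[OF g] U by blast
      ultimately have "\<forall>\<^sub>F v in \<Psi>. v \<in> y ` {j \<in> I. le i j} \<and> v \<in> U"
        by (rule eventually_conj)
      then show "\<exists>j\<in>I. le i j \<and> y j \<in> U"
        using eventually_happens'[OF \<Psi>(2)] by blast
    qed
  qed
qed

theorem proposition1p4:
  fixes G :: "'g top_groupoid" and Y :: "'g set" and x :: 'g
    and I :: "'i set" and le :: "'i \<Rightarrow> 'i \<Rightarrow> bool" and y :: "'i \<Rightarrow> 'g"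
  assumes "etale_groupoid G"
    and "Y \<subseteq> unit_space G"
    and "x \<in> unit_space G - Y"
    and "directed_set I le"
    and "\<forall>i\<in>I. y i \<in> Y"
    and "{g \<in> isotropy G x. accumulation_point (gtop G) I le y g} = {x}"
  shows "weakly_contained (reduced_algebra G)
           (ell2 (src_fibre G x)) (rho_ext G x)
           (ell2_sum Y (src_fibre G)) (rep_sum Y (rho_ext G))"
  unfolding weakly_contained_def
proof
  interpret etale_groupoid G by fact
  have x: "x \<in> unit_space G" using assms(3) by blast
  have acc: "accumulation_point (gtop G) I le y x"
    using assms(6) by blast
  \<comment> \<open>The hypothesis on accumulation points enters twice: x is one, which gives
    \<Phi>, and no other point of the isotropy group is one, which gives \<open>iso\<close>.\<close>
  obtain \<Phi> where \<Phi>: "\<Phi> \<noteq> bot" "limitin (gtop G) (\<lambda>v. v) x \<Phi>" "\<forall>\<^sub>F v in \<Phi>. v \<in> Y"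
    and \<Phi>_acc: "\<And>\<Psi> g. \<Psi> \<le> \<Phi> \<Longrightarrow> \<Psi> \<noteq> bot \<Longrightarrow> limitin (gtop G) (\<lambda>v. v) g \<Psi> \<Longrightarrow>
      accumulation_point (gtop G) I le y g"
    using accumulating_net_filter[OF assms(4,5) acc] by blast
  have units: "\<forall>\<^sub>F v in \<Phi>. v \<in> unit_space G"
    using \<Phi>(3) by (rule eventually_mono) (use assms(2) in blast)
  have iso: "g = x" if "\<Psi> \<le> \<Phi>" "\<Psi> \<noteq> bot" "limitin (gtop G) (\<lambda>v. v) g \<Psi>" "g \<in> isotropy G x" for \<Psi> g
    using \<Phi>_acc[OF that(1-3)] that(4) assms(6) by blast
  fix b assume b: "b \<in> rep_kernel (reduced_algebra G) (ell2_sum Y (src_fibre G)) (rep_sum Y (rho_ext G))"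
  then have bA: "b \<in> elems (reduced_algebra G)"
    by (simp add: rep_kernel_def)
  have zero: "rho_ext G v b = 0" if "v \<in> Y" for v
    using that assms(2) by (intro rep_kernel_rep_sumD[OF b] rho_ext_bounded_ops bA) auto
  have "rho_ext G x b = 0"
  proof (rule rho_ext_eq_0I[OF bA x])
    fix \<sigma> assume \<sigma>b: "\<sigma> \<in> b"
    then have \<sigma>: "\<sigma> \<in> cauchy_seqs G"
      using bA by (auto simp: reduced_algebra_def null_equiv_def elim!: quotientE)
    note ub = cauchy_seqs_uniformly_bounded[OF \<sigma>]
    \<comment> \<open>For each n beyond a common N, the bound e holds over all of Y, hence
      eventually along \<Phi>, and \<open>rho_limit_bound\<close> transfers it to x. Only elements
      of \<open>Cc G\<close> are compared across fibres.\<close>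
    have small: "\<exists>N. \<forall>n\<ge>N. op_norm (src_fibre G x) (rho G x (\<sigma> n)) \<le> e" if "e > 0" for e
    proof -
      obtain N where N: "\<And>n v. n \<ge> N \<Longrightarrow> v \<in> Y \<Longrightarrow> op_norm (src_fibre G v) (rho G v (\<sigma> n)) \<le> e"
        using op_norm_uniformly_small[OF bA \<sigma>b \<sigma> assms(2) zero \<open>e > 0\<close>] by blast
      have "op_norm (src_fibre G x) (rho G x (\<sigma> n)) \<le> e" if n: "n \<ge> N" for n
      proof (rule op_norm_le)
        fix \<xi> assume \<xi>: "\<xi> \<in> ell2 (src_fibre G x)"
        have "\<forall>\<^sub>F v in \<Phi>. \<forall>\<xi>\<in>ell2 (src_fibre G v). rho G v (\<sigma> n) \<xi> \<in> ell2 (src_fibre G v) \<and>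
            ell2_norm (src_fibre G v) (rho G v (\<sigma> n) \<xi>) \<le> e * ell2_norm (src_fibre G v) \<xi>"
          using \<Phi>(3)
        proof (eventually_elim, intro ballI conjI)
          fix v \<xi> assume v: "v \<in> Y" and \<xi>: "\<xi> \<in> ell2 (src_fibre G v)"
          have T: "rho G v (\<sigma> n) \<in> bounded_ops (src_fibre G v)"
            using v assms(2) by (intro rho_bounded_ops ub) auto
          show "rho G v (\<sigma> n) \<xi> \<in> ell2 (src_fibre G v)"
            by (rule bounded_ops_ell2[OF T \<xi>])
          show "ell2_norm (src_fibre G v) (rho G v (\<sigma> n) \<xi>) \<le> e * ell2_norm (src_fibre G v) \<xi>"
            by (rule order_trans[OF ell2_norm_le_op_norm[OF T \<xi>] mult_right_mono[OF N[OF n v]]]) simp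
        qed
        moreover have "\<sigma> n \<in> Cc G"
          using \<sigma> by (auto simp: cauchy_seqs_def)
        ultimately show "ell2_norm (src_fibre G x) (rho G x (\<sigma> n) \<xi>) \<le> e * ell2_norm (src_fibre G x) \<xi>"
          using \<open>e > 0\<close> by (intro rho_limit_bound[OF \<Phi>(2) units iso _ x \<Phi>(1) _ _ \<xi>]) auto
      qed (use \<open>e > 0\<close> in simp)
      then show ?thesis by blast
    qed
    show "(\<lambda>n. op_norm (src_fibre G x) (rho G x (\<sigma> n))) \<longlonglongrightarrow> 0"
    proof (rule LIMSEQ_I)
      fix e :: real assume "e > 0"
      then obtain N where N: "\<forall>n\<ge>N. op_norm (src_fibre G x) (rho G x (\<sigma> n)) \<le> e / 2"
        using small[of "e / 2"] by auto
      have "norm (op_norm (src_fibre G x) (rho G x (\<sigma> n)) - 0) < e" if "n \<ge> N" for n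
        using N that \<open>e > 0\<close> op_norm_nonneg[OF rho_bounded_ops[OF ub x], of n] by force
      then show "\<exists>N. \<forall>n\<ge>N. norm (op_norm (src_fibre G x) (rho G x (\<sigma> n)) - 0) < e"
        by blast
    qed
  qed
  then show "b \<in> rep_kernel (reduced_algebra G) (ell2 (src_fibre G x)) (rho_ext G x)"
    using bA by (simp add: rep_kernel_def)
qed

end
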